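(* There exist incomplete nearly parallel $\mathrm{G}_2$-structures that have $T^4$-symmetry; that is, there is a $7$-manifold $M$ with a nearly parallel $\mathrm{G}_2$-structure $\varphi$ whose induced Riemannian metric is incomplete, together with an effective action of a four-torus $T^4$ on $M$ preserving $\varphi$.
   Context: A $\mathrm{G}_2$-structure on a $7$-manifold $M$ is a three-form $\varphi$ that at each point, in some coframe $e^1,\dots,e^7$, equals $e^{123}-e^1(e^{45}+e^{67})-e^2(e^{46}+e^{75})-e^3(e^{47}+e^{56})$ (with $e^{ijk}=e^i\wedge e^j\wedge e^k$, etc.). It determines a Riemannian metric $g$ and volume form by $6g(X,Y)\mathrm{vol}=(X\lrcorner\varphi)\wedge(Y\lrcorner\varphi)\wedge\varphi$, and hence a Hodge star $\star$. It is nearly parallel if, after normalisation by homothety, $d\varphi=4\,{\star\varphi}$. *)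

theory Defs
  imports "HOL-Analysis.Analysis"
begin

section \<open>Smooth maps between open subsets of Euclidean spaces\<close>

text \<open>Only meaningful for an open set \<open>S\<close>: \<open>C_on k f S\<close> says that all iterated partial
  derivatives of \<open>f\<close> of order at most \<open>k\<close> exist (as derivatives of differentiable maps) and are
  continuous.\<close>

primrec C_on :: "nat \<Rightarrow> ('a::euclidean_space \<Rightarrow> 'b::real_normed_vector) \<Rightarrow> 'a set \<Rightarrow> bool" where
  "C_on 0 f S \<longleftrightarrow> continuous_on S f"
| "C_on (Suc k) f S \<longleftrightarrow> (\<forall>x\<in>S. f differentiable (at x)) \<and>
     (\<forall>b\<in>Basis. C_on k (\<lambda>x. frechet_derivative f (at x) b) S)"

definition smooth_on :: "('a::euclidean_space \<Rightarrow> 'b::real_normed_vector) \<Rightarrow> 'a set \<Rightarrow> bool" where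
  "smooth_on f S \<longleftrightarrow> (\<forall>k. C_on k f S)"


section \<open>Smooth manifolds\<close>

text \<open>A chart is a pair of its domain and its coordinate map (which is irrelevant off the domain).
  The atlas need not be maximal.\<close>

type_synonym ('a, 'e) chart = "'a set \<times> ('a \<Rightarrow> 'e)"

abbreviation dom_of :: "('a, 'e) chart \<Rightarrow> 'a set" where "dom_of \<equiv> fst"

abbreviation coord :: "('a, 'e) chart \<Rightarrow> 'a \<Rightarrow> 'e" where "coord \<equiv> snd"

definition coord_inv :: "('a, 'e) chart \<Rightarrow> 'e \<Rightarrow> 'a" where
  "coord_inv c = inv_into (dom_of c) (coord c)"

definition smooth_manifold :: "'a topology \<Rightarrow> ('a, 'e::euclidean_space) chart set \<Rightarrow> bool" where
  "smooth_manifold X A \<longleftrightarrow>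
     Hausdorff_space X \<and> second_countable X \<and>
     (\<Union>c\<in>A. dom_of c) = topspace X \<and>
     (\<forall>c\<in>A. openin X (dom_of c) \<and> open (coord c ` dom_of c) \<and>
        homeomorphic_map (subtopology X (dom_of c)) (top_of_set (coord c ` dom_of c)) (coord c)) \<and>
     (\<forall>c\<in>A. \<forall>d\<in>A. smooth_on (coord d \<circ> coord_inv c) (coord c ` (dom_of c \<inter> dom_of d)))"

definition smooth_map ::
  "'a topology \<Rightarrow> ('a, 'e::euclidean_space) chart set \<Rightarrow>
   'b topology \<Rightarrow> ('b, 'f::euclidean_space) chart set \<Rightarrow> ('a \<Rightarrow> 'b) \<Rightarrow> bool" where
  "smooth_map X A Y B f \<longleftrightarrow> continuous_map X Y f \<and>
     (\<forall>c\<in>A. \<forall>d\<in>B. smooth_on (coord d \<circ> f \<circ> coord_inv c)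
        (coord c ` {p \<in> dom_of c. f p \<in> dom_of d}))"

definition prod_atlas ::
  "('a, 'e) chart set \<Rightarrow> ('b, 'f) chart set \<Rightarrow> ('a \<times> 'b, 'e \<times> 'f) chart set" where
  "prod_atlas A B =
     (\<lambda>(c, d). (dom_of c \<times> dom_of d, \<lambda>(p, q). (coord c p, coord d q))) ` (A \<times> B)"


section \<open>The torus and its smooth actions\<close>

text \<open>The torus is the group of vectors of unit complex numbers; its group operation is the
  componentwise product \<open>*\<close> of vectors, with unit \<open>1\<close>. Its charts are the angle coordinates with
  values in an open cube of side \<open>2 * pi\<close>.\<close>

definition torus :: "(complex ^ 'n) set" where
  "torus = {z. \<forall>i. cmod (z $ i) = 1}"

definition torus_exp :: "real ^ 'n \<Rightarrow> complex ^ 'n" where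
  "torus_exp t = (\<chi> i. cis (t $ i))"

definition angle_cube :: "real ^ 'n \<Rightarrow> (real ^ 'n) set" where
  "angle_cube a = {t. \<forall>i. \<bar>t $ i - a $ i\<bar> < pi}"

definition torus_atlas :: "(complex ^ 'n, real ^ 'n) chart set" where
  "torus_atlas =
     range (\<lambda>a. (torus_exp ` angle_cube a, inv_into (angle_cube a) torus_exp))"

definition smooth_torus_action ::
  "'a topology \<Rightarrow> ('a, 'e::euclidean_space) chart set \<Rightarrow> (complex ^ 'n \<Rightarrow> 'a \<Rightarrow> 'a) \<Rightarrow> bool" where
  "smooth_torus_action X A act \<longleftrightarrow>
     (\<forall>p\<in>topspace X. act 1 p = p) \<and>
     (\<forall>s\<in>torus. \<forall>t\<in>torus. \<forall>p\<in>topspace X. act (s * t) p = act s (act t p)) \<and>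
     smooth_map (prod_topology (top_of_set torus) X) (prod_atlas torus_atlas A) X A
       (\<lambda>(t, p). act t p)"

definition effective_torus_action :: "'a topology \<Rightarrow> (complex ^ 'n \<Rightarrow> 'a \<Rightarrow> 'a) \<Rightarrow> bool" where
  "effective_torus_action X act \<longleftrightarrow>
     (\<forall>t\<in>torus. (\<forall>p\<in>topspace X. act t p = p) \<longrightarrow> t = 1)"


section \<open>Exterior algebra of a Euclidean space\<close>

text \<open>A \<open>k\<close>-covector takes a sequence of vectors, of which it only uses the entries
  \<open>v 0, \<dots>, v (k - 1)\<close>.\<close>

type_synonym 'e covector = "(nat \<Rightarrow> 'e) \<Rightarrow> real"

definition kcovector :: "nat \<Rightarrow> 'e::euclidean_space covector \<Rightarrow> bool" where
  "kcovector k \<alpha> \<longleftrightarrow>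
     (\<forall>v w. (\<forall>i<k. v i = w i) \<longrightarrow> \<alpha> v = \<alpha> w) \<and>
     (\<forall>v. \<forall>i<k. linear (\<lambda>x. \<alpha> (v(i := x)))) \<and>
     (\<forall>v. \<forall>i<k. \<forall>j<k. i \<noteq> j \<longrightarrow> v i = v j \<longrightarrow> \<alpha> v = 0)"

text \<open>Normalised so that \<open>e\<^sup>1 \<and> \<dots> \<and> e\<^sup>n\<close> is the determinant of the components.\<close>

definition wedge :: "nat \<Rightarrow> nat \<Rightarrow> 'e covector \<Rightarrow> 'e covector \<Rightarrow> 'e covector" where
  "wedge p q \<alpha> \<beta> = (\<lambda>v. (\<Sum>\<sigma> | \<sigma> permutes {..<p + q}.
      of_int (sign \<sigma>) * \<alpha> (\<lambda>i. v (\<sigma> i)) * \<beta> (\<lambda>i. v (\<sigma> (p + i)))) / (fact p * fact q))"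

definition interior_prod :: "'e \<Rightarrow> 'e covector \<Rightarrow> 'e covector" where
  "interior_prod x \<alpha> = (\<lambda>v. \<alpha> (case_nat x v))"

definition pullback :: "('e \<Rightarrow> 'f) \<Rightarrow> 'f covector \<Rightarrow> 'e covector" where
  "pullback L \<alpha> = (\<lambda>v. \<alpha> (\<lambda>i. L (v i)))"

definition inner_product_form :: "('e::euclidean_space \<Rightarrow> 'e \<Rightarrow> real) \<Rightarrow> bool" where
  "inner_product_form g \<longleftrightarrow>
     bilinear g \<and> (\<forall>x y. g x y = g y x) \<and> (\<forall>x. x \<noteq> 0 \<longrightarrow> g x x > 0)"

definition orthonormal_frame ::
  "('e::euclidean_space \<Rightarrow> 'e \<Rightarrow> real) \<Rightarrow> (nat \<Rightarrow> 'e) \<Rightarrow> bool" where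
  "orthonormal_frame g b \<longleftrightarrow>
     (\<forall>i<DIM('e). \<forall>j<DIM('e). g (b i) (b j) = (if i = j then 1 else 0))"

text \<open>One of the two volume forms of \<open>g\<close>; the choice is an orientation.\<close>

definition volume_form_of ::
  "('e::euclidean_space \<Rightarrow> 'e \<Rightarrow> real) \<Rightarrow> 'e covector \<Rightarrow> bool" where
  "volume_form_of g vol \<longleftrightarrow> kcovector DIM('e) vol \<and> (\<exists>b. orthonormal_frame g b \<and> vol b = 1)"

text \<open>For an orthonormal frame \<open>b\<close> this is the induced inner product on \<open>k\<close>-covectors; the value does
  not depend on \<open>b\<close>. The division accounts for summing over all index tuples instead of
  the increasing ones.\<close>

definition covector_inner ::
  "(nat \<Rightarrow> 'e::euclidean_space) \<Rightarrow> nat \<Rightarrow> 'e covector \<Rightarrow> 'e covector \<Rightarrow> real" where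
  "covector_inner b k \<alpha> \<beta> =
     (\<Sum>f\<in>{..<k} \<rightarrow>\<^sub>E {..<DIM('e)}. \<alpha> (\<lambda>i. b (f i)) * \<beta> (\<lambda>i. b (f i))) / fact k"

text \<open>\<open>\<beta> = \<star>\<alpha>\<close>, that is \<open>\<gamma> \<and> \<beta> = \<langle>\<gamma>, \<alpha>\<rangle> vol\<close> for all \<open>k\<close>-covectors \<open>\<gamma>\<close>.\<close>

definition is_hodge_star ::
  "('e::euclidean_space \<Rightarrow> 'e \<Rightarrow> real) \<Rightarrow> 'e covector \<Rightarrow> nat \<Rightarrow> 'e covector \<Rightarrow> 'e covector \<Rightarrow> bool"
  where
  "is_hodge_star g vol k \<alpha> \<beta> \<longleftrightarrow>
     kcovector (DIM('e) - k) \<beta> \<and>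
     (\<exists>b. orthonormal_frame g b \<and>
        (\<forall>\<gamma>. kcovector k \<gamma> \<longrightarrow>
           (\<forall>v. wedge k (DIM('e) - k) \<gamma> \<beta> v = covector_inner b k \<gamma> \<alpha> * vol v)))"


section \<open>Differential forms and Riemannian metrics on manifolds\<close>

text \<open>A tensor field is the family of its local representatives: for each chart \<open>c\<close>, a tensor at
  each point of the open set \<open>coord c ` dom_of c\<close>. The local representatives of a form are related
  by pullback along the coordinate changes.\<close>

type_synonym ('a, 'e) form = "('a, 'e) chart \<Rightarrow> 'e \<Rightarrow> 'e covector"

type_synonym ('a, 'e) metric = "('a, 'e) chart \<Rightarrow> 'e \<Rightarrow> 'e \<Rightarrow> 'e \<Rightarrow> real"

definition differential_form ::
  "('a, 'e::euclidean_space) chart set \<Rightarrow> nat \<Rightarrow> ('a, 'e) form \<Rightarrow> bool" where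
  "differential_form A k \<omega> \<longleftrightarrow>
     (\<forall>c\<in>A. (\<forall>x\<in>coord c ` dom_of c. kcovector k (\<omega> c x)) \<and>
             (\<forall>v. smooth_on (\<lambda>x. \<omega> c x v) (coord c ` dom_of c))) \<and>
     (\<forall>c\<in>A. \<forall>d\<in>A. \<forall>p\<in>dom_of c \<inter> dom_of d.
        \<omega> c (coord c p) =
          pullback (frechet_derivative (coord d \<circ> coord_inv c) (at (coord c p))) (\<omega> d (coord d p)))"

text \<open>The exterior derivative of a \<open>k\<close>-form on an open set, by the invariant formula evaluated on
  constant vector fields (whose brackets vanish).\<close>

definition ext_deriv ::
  "nat \<Rightarrow> ('e::euclidean_space \<Rightarrow> 'e covector) \<Rightarrow> 'e \<Rightarrow> 'e covector" where
  "ext_deriv k \<omega> x = (\<lambda>v. \<Sum>i\<le>k. (- 1) ^ i *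
      frechet_derivative (\<lambda>y. \<omega> y (\<lambda>j. if j < i then v j else v (Suc j))) (at x) (v i))"

definition preserves_form ::
  "('a, 'e::euclidean_space) chart set \<Rightarrow> ('a, 'e) form \<Rightarrow> ('a \<Rightarrow> 'a) \<Rightarrow> bool" where
  "preserves_form A \<omega> f \<longleftrightarrow>
     (\<forall>c\<in>A. \<forall>d\<in>A. \<forall>p\<in>dom_of c. f p \<in> dom_of d \<longrightarrow>
        \<omega> c (coord c p) =
          pullback (frechet_derivative (coord d \<circ> f \<circ> coord_inv c) (at (coord c p)))
            (\<omega> d (coord d (f p))))"

text \<open>\<open>s\<close> is the speed, off a finite set of parameters, of a piecewise \<open>C\<^sup>1\<close> curve. Requiring
  \<open>has_integral\<close> (rather than using \<open>integral\<close>) excludes curves of infinite length, for which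
  \<open>integral\<close> would return the value \<open>0\<close>.\<close>

definition curve_of_length ::
  "'a topology \<Rightarrow> ('a, 'e::euclidean_space) chart set \<Rightarrow> ('a, 'e) metric \<Rightarrow>
   (real \<Rightarrow> 'a) \<Rightarrow> real \<Rightarrow> bool" where
  "curve_of_length X A g \<gamma> L \<longleftrightarrow>
     continuous_map (top_of_set {0..1}) X \<gamma> \<and>
     (\<exists>S s. finite S \<and>
        (\<forall>c\<in>A. (coord c \<circ> \<gamma>) C1_differentiable_on ({t\<in>{0..1}. \<gamma> t \<in> dom_of c} - S)) \<and>
        (\<forall>t\<in>{0..1} - S. \<forall>c\<in>A. \<gamma> t \<in> dom_of c \<longrightarrow>
           s t = (let w = vector_derivative (coord c \<circ> \<gamma>) (at t)
                  in sqrt (g c (coord c (\<gamma> t)) w w))) \<and>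
        (s has_integral L) {0..1})"

definition riemannian_dist ::
  "'a topology \<Rightarrow> ('a, 'e::euclidean_space) chart set \<Rightarrow> ('a, 'e) metric \<Rightarrow> 'a \<Rightarrow> 'a \<Rightarrow> real" where
  "riemannian_dist X A g p q =
     Inf {L. \<exists>\<gamma>. \<gamma> 0 = p \<and> \<gamma> 1 = q \<and> curve_of_length X A g \<gamma> L}"

text \<open>Metric completeness for the Riemannian distance of a connected manifold. This is
  \<open>Metric_space.mcomplete\<close> written out.\<close>

definition riemannian_complete ::
  "'a topology \<Rightarrow> ('a, 'e::euclidean_space) chart set \<Rightarrow> ('a, 'e) metric \<Rightarrow> bool" where
  "riemannian_complete X A g \<longleftrightarrow>
     (\<forall>\<sigma>. range \<sigma> \<subseteq> topspace X \<longrightarrow>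
        (\<forall>\<epsilon>>0. \<exists>N::nat. \<forall>m\<ge>N. \<forall>n\<ge>N. riemannian_dist X A g (\<sigma> m) (\<sigma> n) < \<epsilon>) \<longrightarrow>
        (\<exists>p\<in>topspace X. (\<lambda>n. riemannian_dist X A g (\<sigma> n) p) \<longlonglongrightarrow> 0))"


section \<open>Nearly parallel \<open>G\<^sub>2\<close>-structures\<close>

text \<open>A coframe \<open>e 1, \<dots>, e 7\<close> is a basis of the dual space; index \<open>0\<close> is unused.\<close>

definition coframe :: "(nat \<Rightarrow> real ^ 7 \<Rightarrow> real) \<Rightarrow> bool" where
  "coframe e \<longleftrightarrow> (\<forall>i\<in>{1..7}. linear (e i)) \<and>
     (\<forall>a. (\<forall>x. (\<Sum>i=1..7. a i * e i x) = 0) \<longrightarrow> (\<forall>i\<in>{1..7}. a i = 0))"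

definition triple_wedge ::
  "(nat \<Rightarrow> 'e \<Rightarrow> real) \<Rightarrow> nat \<Rightarrow> nat \<Rightarrow> nat \<Rightarrow> 'e covector" where
  "triple_wedge e i j k =
     wedge 2 1 (wedge 1 1 (\<lambda>v. e i (v 0)) (\<lambda>v. e j (v 0))) (\<lambda>v. e k (v 0))"

definition standard_G2_form :: "(nat \<Rightarrow> real ^ 7 \<Rightarrow> real) \<Rightarrow> (real ^ 7) covector" where
  "standard_G2_form e = (\<lambda>v. triple_wedge e 1 2 3 v
     - (triple_wedge e 1 4 5 v + triple_wedge e 1 6 7 v)
     - (triple_wedge e 2 4 6 v + triple_wedge e 2 7 5 v)
     - (triple_wedge e 3 4 7 v + triple_wedge e 3 5 6 v))"

definition G2_structure :: "('a, real ^ 7) chart set \<Rightarrow> ('a, real ^ 7) form \<Rightarrow> bool" where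
  "G2_structure A \<phi> \<longleftrightarrow> differential_form A 3 \<phi> \<and>
     (\<forall>c\<in>A. \<forall>x\<in>coord c ` dom_of c. \<exists>e. coframe e \<and> \<phi> c x = standard_G2_form e)"

text \<open>The identity \<open>6 g(X,Y) vol = (X \<lrcorner> \<phi>) \<and> (Y \<lrcorner> \<phi>) \<and> \<phi>\<close> determines \<open>g\<close> and \<open>vol\<close>
  (including the orientation), given that \<open>vol\<close> is a volume form of \<open>g\<close>.\<close>

definition G2_metric_and_volume ::
  "('a, real ^ 7) chart set \<Rightarrow> ('a, real ^ 7) form \<Rightarrow> ('a, real ^ 7) metric \<Rightarrow>
   ('a, real ^ 7) form \<Rightarrow> bool" where
  "G2_metric_and_volume A \<phi> g vol \<longleftrightarrow>
     (\<forall>c\<in>A. \<forall>x\<in>coord c ` dom_of c.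
        inner_product_form (g c x) \<and> volume_form_of (g c x) (vol c x) \<and>
        (\<forall>X Y v. 6 * g c x X Y * vol c x v =
           wedge 4 3 (wedge 2 2 (interior_prod X (\<phi> c x)) (interior_prod Y (\<phi> c x))) (\<phi> c x) v))"

text \<open>The normalised equation \<open>d\<phi> = 4 \<star>\<phi>\<close>.\<close>

definition nearly_parallel ::
  "('a, real ^ 7) chart set \<Rightarrow> ('a, real ^ 7) form \<Rightarrow> ('a, real ^ 7) metric \<Rightarrow>
   ('a, real ^ 7) form \<Rightarrow> bool" where
  "nearly_parallel A \<phi> g vol \<longleftrightarrow>
     (\<forall>c\<in>A. \<forall>x\<in>coord c ` dom_of c.
        \<exists>\<psi>. is_hodge_star (g c x) (vol c x) 3 (\<phi> c x) \<psi> \<and>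
            ext_deriv 3 (\<phi> c) x = (\<lambda>v. 4 * \<psi> v))"

text \<open>Since a manifold has at most the cardinality of the continuum and its topology is arbitrary
  (not tied to that of the carrier type), every manifold is diffeomorphic to one carried by a
  subset of the following type.\<close>

type_synonym point = "(complex ^ 4) \<times> (real ^ 3)"

end

theory Submission
  imports Defs
begin

text \<open>On the product of \<open>T\<^sup>4\<close> with a slab in \<open>\<real>\<^sup>3\<close> there is an explicit invariant solution of cohomogeneity
  one. Its multi-moment map \<open>\<phi>(U\<^sub>i, U\<^sub>j, U\<^sub>k)\<close> immerses the slab into \<open>\<real>\<^sup>4\<close>; asking for two further
  translational symmetries of this hypersurface reduces the nearly parallel equation to an ordinary
  differential equation in one variable \<open>r\<close>. The solution has an adapted coframe \<open>e\<^sup>1, \<dots>, e\<^sup>7\<close> with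
  \<open>e\<^sup>1 = dr\<close> whose structure functions are affine in \<open>k = tan (10 r)\<close> with integer coefficients, so that
  \<open>d\<phi> = 4 \<star>\<phi>\<close> becomes an identity between integer combinations of the products \<open>e\<^sup>i \<and> e\<^sup>j \<and> e\<^sup>k \<and> e\<^sup>l\<close>.
  The slab is \<open>\<bar>r\<bar> < 1 / 10\<close>, and since \<open>dr\<close> has unit length, the radial curve running into
  \<open>r = 1 / 10\<close> has finite length but no limit.\<close>


section \<open>Exterior products of 1-forms\<close>

text \<open>Wedges of total degree 7 are sums over 5040 permutations, and the metric and Hodge
  identities quantify over all vectors and covectors. Multilinearity tames both: everything is
  expanded in products of members of the coframe, where \<open>wedge\<close> is concatenation of
  lists and equality is decided by sorting indices. This wants integer coefficients, hence structure
  functions that are a constant plus a multiple of one function k; the two coefficients are then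
  checked separately. The tilt of e^7 by k achieves this: with t the first angle, dt = rho^3 (e^7 +
  k e^6), and the terms k^2 e^16 in de^7 cancel because 6 - 2 - 4 = 0. Invariance keeps the global
  part short. The coframe depends on the slab coordinates only, and changes of angle coordinates are
  local translations, so one formula on \<real>^7 serves in every chart and every pullback is along
  the identity. The width of the slab is a choice: the profile functions stay regular as long as 10
  |r| < pi / 2, and with 1 / 10 this holds on the closed slab by pi > 3 alone.\<close>

definition wedge_list :: "('e \<Rightarrow> real) list \<Rightarrow> 'e covector" where
  "wedge_list fs v = (\<Sum>\<sigma> | \<sigma> permutes {..<length fs}.
     of_int (sign \<sigma>) * (\<Prod>i<length fs. (fs ! i) (v (\<sigma> i))))"

lemma prod_lessThan_add:
  fixes f :: "nat \<Rightarrow> 'a::comm_monoid_mult"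
  shows "(\<Prod>i<p + q. f i) = (\<Prod>i<p. f i) * (\<Prod>j<q. f (p + j))"
  by (induction q) (simp_all add: mult_ac)

text \<open>For fixed permutations of the two blocks, reindexing the outer sum by their block sum
  turns the summand into that of the concatenation. Each of the \<open>fact p * fact q\<close> pairs
  thus gives the same total, and this number is what the normalisation of \<open>wedge\<close>
  divides by.\<close>

lemma wedge_wedge_list:
  "wedge (length fs) (length gs) (wedge_list fs) (wedge_list gs) = wedge_list (fs @ gs)"
proof
  fix v :: "nat \<Rightarrow> 'a"
  define p q where "p = length fs" and "q = length gs"
  let ?F = "\<lambda>\<sigma> \<tau>. of_int (sign \<tau>) * (\<Prod>i<p. (fs ! i) (v (\<sigma> (\<tau> i))))"
  let ?G = "\<lambda>\<sigma> \<rho>. of_int (sign \<rho>) * (\<Prod>j<q. (gs ! j) (v (\<sigma> (p + \<rho> j))))"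
  have block: "(\<Sum>\<sigma> | \<sigma> permutes {..<p + q}. of_int (sign \<sigma>) * ?F \<sigma> \<tau> * ?G \<sigma> \<rho>)
      = wedge_list (fs @ gs) v"
    if \<tau>: "\<tau> permutes {..<p}" and \<rho>: "\<rho> permutes {..<q}" for \<tau> \<rho>
  proof -
    \<comment> \<open>The permutation of the second block, moved up by \<open>p\<close>; then
      \<open>\<kappa>\<close> acts by \<open>\<tau>\<close> below \<open>p\<close> and by the
      shifted \<open>\<rho>\<close> from \<open>p\<close> on.\<close>
    define \<rho>' where "\<rho>' = map_permutation {..<q} ((+) p) \<rho>"
    define \<kappa> where "\<kappa> = \<tau> \<circ> \<rho>'"
    have "(+) p ` {..<q} = {p..<p + q}"
      by (simp add: lessThan_atLeast0 add.commute)
    then have \<rho>'p: "\<rho>' permutes {p..<p + q}"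
      unfolding \<rho>'_def using map_permutation_permutes[where f = "(+) p" and A = "{..<q}" and B = "{p..<p+q}" and p = \<rho>] \<rho>
      by (simp add: bij_betw_def)
    have \<rho>'_add: "\<rho>' (p + j) = p + \<rho> j" if "j < q" for j
      unfolding \<rho>'_def using map_permutation_apply[where f = "(+) p" and A = "{..<q}" and x = j and h = \<rho>] that by simp
    have \<rho>'_less: "\<rho>' i = i" if "i < p" for i
      using permutes_not_in[OF \<rho>'p] that by simp
    have \<kappa>_less: "\<kappa> i = \<tau> i" if "i < p" for i
      using that by (simp add: \<kappa>_def \<rho>'_less)
    have \<kappa>_add: "\<kappa> (p + j) = p + \<rho> j" if "j < q" for j
      using permutes_not_in[OF \<tau>] that by (simp add: \<kappa>_def \<rho>'_add)
    have \<kappa>: "\<kappa> permutes {..<p + q}"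
      unfolding \<kappa>_def
      by (intro permutes_compose) (auto intro: permutes_subset[OF \<tau>] permutes_subset[OF \<rho>'p])
    have perm: "permutation \<tau>" "permutation \<rho>'"
      using \<tau> \<rho>'p by (auto simp: permutation_permutes)
    have "sign \<rho>' = sign \<rho>"
      unfolding \<rho>'_def using \<rho> by (intro sign_map_permutation) auto
    then have sign_\<kappa>: "sign \<kappa> = sign \<tau> * sign \<rho>"
      using perm by (simp add: \<kappa>_def sign_compose)
    have perm_\<kappa>: "permutation \<kappa>"
      using \<kappa> by (auto simp: permutation_permutes)
    have "wedge_list (fs @ gs) v = (\<Sum>\<sigma> | \<sigma> permutes {..<p + q}.
        of_int (sign (\<sigma> \<circ> \<kappa>)) * (\<Prod>i<p + q. ((fs @ gs) ! i) (v ((\<sigma> \<circ> \<kappa>) i))))"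
      unfolding wedge_list_def length_append p_def[symmetric] q_def[symmetric]
      by (rule sum_permutations_compose_right[OF \<kappa>])
    also have "\<dots> = (\<Sum>\<sigma> | \<sigma> permutes {..<p + q}. of_int (sign \<sigma>) * ?F \<sigma> \<tau> * ?G \<sigma> \<rho>)"
    proof (rule sum.cong[OF refl])
      fix \<sigma> assume "\<sigma> \<in> {\<sigma>. \<sigma> permutes {..<p + q}}"
      then have "permutation \<sigma>"
        by (auto simp: permutation_permutes)
      then have "sign (\<sigma> \<circ> \<kappa>) = sign \<sigma> * (sign \<tau> * sign \<rho>)"
        using perm_\<kappa> by (simp add: sign_compose sign_\<kappa>)
      moreover have "(\<Prod>i<p + q. ((fs @ gs) ! i) (v ((\<sigma> \<circ> \<kappa>) i)))
          = (\<Prod>i<p. (fs ! i) (v (\<sigma> (\<tau> i)))) * (\<Prod>j<q. (gs ! j) (v (\<sigma> (p + \<rho> j))))"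
        unfolding prod_lessThan_add
        by (intro arg_cong2[where f = "(*)"] prod.cong)
           (auto simp: \<kappa>_less \<kappa>_add[unfolded p_def] nth_append p_def)
      ultimately show "of_int (sign (\<sigma> \<circ> \<kappa>)) * (\<Prod>i<p + q. ((fs @ gs) ! i) (v ((\<sigma> \<circ> \<kappa>) i)))
          = of_int (sign \<sigma>) * ?F \<sigma> \<tau> * ?G \<sigma> \<rho>"
        by (simp add: mult_ac)
    qed
    finally show ?thesis by simp
  qed
  have "(\<Sum>\<sigma> | \<sigma> permutes {..<p + q}. of_int (sign \<sigma>) *
        (\<Sum>\<tau> | \<tau> permutes {..<p}. ?F \<sigma> \<tau>) * (\<Sum>\<rho> | \<rho> permutes {..<q}. ?G \<sigma> \<rho>))
      = (\<Sum>\<sigma> | \<sigma> permutes {..<p + q}. \<Sum>\<tau> | \<tau> permutes {..<p}. \<Sum>\<rho> | \<rho> permutes {..<q}.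
          of_int (sign \<sigma>) * ?F \<sigma> \<tau> * ?G \<sigma> \<rho>)"
    by (intro sum.cong refl) (simp only: sum_distrib_left sum_distrib_right, rule sum.swap)
  also have "\<dots> = (\<Sum>\<tau> | \<tau> permutes {..<p}. \<Sum>\<rho> | \<rho> permutes {..<q}.
      \<Sum>\<sigma> | \<sigma> permutes {..<p + q}. of_int (sign \<sigma>) * ?F \<sigma> \<tau> * ?G \<sigma> \<rho>)"
    by (subst sum.swap, rule sum.cong[OF refl], rule sum.swap)
  also have "\<dots> = (\<Sum>\<tau> | \<tau> permutes {..<p}. \<Sum>\<rho> | \<rho> permutes {..<q}. wedge_list (fs @ gs) v)"
    by (intro sum.cong refl block) auto
  also have "\<dots> = fact p * fact q * wedge_list (fs @ gs) v"
    by (simp add: card_permutations[OF refl])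
  finally show "wedge (length fs) (length gs) (wedge_list fs) (wedge_list gs) v
      = wedge_list (fs @ gs) v"
    by (simp add: wedge_def wedge_list_def p_def q_def field_simps)
qed

lemma wedge_list_1: "wedge_list [f] v = f (v 0)"
  by (simp add: wedge_list_def lessThan_Suc)

lemma wedge_list_2: "wedge_list [f, g] v = f (v 0) * g (v 1) - f (v 1) * g (v 0)"
  by (simp add: wedge_list_def lessThan_Suc sum_over_permutations_insert sign_swap_id sign_compose
      permutation_swap_id permutes_sing)

lemma wedge_list_3: "wedge_list [f, g, h] v =
  f (v 0) * (g (v 1) * h (v 2) - g (v 2) * h (v 1))
  - f (v 1) * (g (v 0) * h (v 2) - g (v 2) * h (v 0))
  + f (v 2) * (g (v 0) * h (v 1) - g (v 1) * h (v 0))"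
  by (simp add: wedge_list_def lessThan_Suc sum_over_permutations_insert sign_swap_id sign_compose
      permutation_swap_id permutes_sing permutation_compose Transposition.transpose_def numeral_2_eq_2)
    (simp add: algebra_simps)

text \<open>Laplace expansion along the first two forms. The shape is that of
  \<open>shuffle22\<close>, which takes over where the factors of degree two are not given as
  products.\<close>

lemma wedge_list_4: "wedge_list [f, g, h, k] v =
  wedge_list [f, g] (\<lambda>i. [v 0, v 1] ! i) * wedge_list [h, k] (\<lambda>i. [v 2, v 3] ! i)
  - wedge_list [f, g] (\<lambda>i. [v 0, v 2] ! i) * wedge_list [h, k] (\<lambda>i. [v 1, v 3] ! i)
  + wedge_list [f, g] (\<lambda>i. [v 0, v 3] ! i) * wedge_list [h, k] (\<lambda>i. [v 1, v 2] ! i)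
  + wedge_list [f, g] (\<lambda>i. [v 1, v 2] ! i) * wedge_list [h, k] (\<lambda>i. [v 0, v 3] ! i)
  - wedge_list [f, g] (\<lambda>i. [v 1, v 3] ! i) * wedge_list [h, k] (\<lambda>i. [v 0, v 2] ! i)
  + wedge_list [f, g] (\<lambda>i. [v 2, v 3] ! i) * wedge_list [h, k] (\<lambda>i. [v 0, v 1] ! i)"
  unfolding wedge_list_2
  by (simp add: wedge_list_def lessThan_Suc sum_over_permutations_insert sign_swap_id sign_compose
      permutation_swap_id permutes_sing permutation_compose Transposition.transpose_def numeral_2_eq_2 numeral_3_eq_3)
    (simp add: algebra_simps)

lemma wedge_list_cong:
  assumes "\<And>i. i < length fs \<Longrightarrow> v i = w i"
  shows "wedge_list fs v = wedge_list fs w"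
  unfolding wedge_list_def
  by (intro sum.cong refl arg_cong2[where f = "(*)"] prod.cong)
     (metis (mono_tags, lifting) assms lessThan_iff mem_Collect_eq permutes_in_image)

text \<open>Each permutation puts a given argument into exactly one factor, which gives linearity.
  For two equal arguments, composing with their transposition flips every sign and keeps every
  product, so the sum is its own negative.\<close>

lemma kcovector_wedge_list:
  fixes fs :: "('e::euclidean_space \<Rightarrow> real) list"
  assumes lin: "\<And>f. f \<in> set fs \<Longrightarrow> linear f"
  shows "kcovector (length fs) (wedge_list fs)"
  unfolding kcovector_def
proof (intro conjI allI impI)
  fix v w :: "nat \<Rightarrow> 'e" assume "\<forall>i<length fs. v i = w i"
  then show "wedge_list fs v = wedge_list fs w"
    by (intro wedge_list_cong) auto
next
  fix v :: "nat \<Rightarrow> 'e" and i assume i: "i < length fs"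
  have "linear (\<lambda>x. of_int (sign \<sigma>) * (\<Prod>j<length fs. (fs ! j) ((v(i := x)) (\<sigma> j))))"
    if \<sigma>: "\<sigma> permutes {..<length fs}" for \<sigma>
  proof -
    obtain j where j: "j < length fs" "\<sigma> j = i"
      using \<sigma> i by (metis lessThan_iff permutes_def permutes_in_image)
    have "(\<Prod>j<length fs. (fs ! j) ((v(i := x)) (\<sigma> j)))
        = (fs ! j) x * (\<Prod>j\<in>{..<length fs} - {j}. (fs ! j) (v (\<sigma> j)))" for x
    proof -
      have "\<sigma> l \<noteq> i" if "l \<noteq> j" for l
        using permutes_inj[OF \<sigma>] j that by (metis injD)
      then show ?thesis
        using j by (subst prod.remove[of _ j]) (auto intro!: prod.cong)
    qed
    moreover have "linear (fs ! j)"
      using lin j by simp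
    ultimately show ?thesis
      by (simp add: linear_iff algebra_simps)
  qed
  then show "linear (\<lambda>x. wedge_list fs (v(i := x)))"
    unfolding wedge_list_def by (intro linear_compose_sum) auto
next
  fix v :: "nat \<Rightarrow> 'e" and i j
  assume ij: "i < length fs" "j < length fs" "i \<noteq> j" "v i = v j"
  have tr: "Transposition.transpose i j permutes {..<length fs}"
    using ij by (intro permutes_swap_id) auto
  have "wedge_list fs v = (\<Sum>\<sigma> | \<sigma> permutes {..<length fs}.
     of_int (sign (Transposition.transpose i j \<circ> \<sigma>)) * (\<Prod>l<length fs. (fs ! l) (v ((Transposition.transpose i j \<circ> \<sigma>) l))))"
    unfolding wedge_list_def by (rule setum_permutations_compose_left[OF tr])
  also have "\<dots> = - wedge_list fs v"
    unfolding wedge_list_def sum_negf[symmetric]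
  proof (rule sum.cong[OF refl])
    fix \<sigma> assume "\<sigma> \<in> {\<sigma>. \<sigma> permutes {..<length fs}}"
    then have "permutation \<sigma>"
      by (auto simp: permutation_permutes)
    then have "sign (Transposition.transpose i j \<circ> \<sigma>) = - sign \<sigma>"
      using ij by (simp add: sign_compose permutation_swap_id sign_swap_id)
    moreover have "v (Transposition.transpose i j m) = v m" for m
      using ij by (simp add: Transposition.transpose_def)
    ultimately show "of_int (sign (Transposition.transpose i j \<circ> \<sigma>)) * (\<Prod>l<length fs. (fs ! l) (v ((Transposition.transpose i j \<circ> \<sigma>) l)))
        = - (of_int (sign \<sigma>) * (\<Prod>l<length fs. (fs ! l) (v (\<sigma> l))))"
      by simp
  qed
  finally show "wedge_list fs v = 0" by simp
qed

lemma wedge_add_left: "wedge p q (\<lambda>v. \<alpha> v + \<alpha>' v) \<beta> v = wedge p q \<alpha> \<beta> v + wedge p q \<alpha>' \<beta> v"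
  and wedge_add_right: "wedge p q \<alpha> (\<lambda>v. \<beta> v + \<beta>' v) v = wedge p q \<alpha> \<beta> v + wedge p q \<alpha> \<beta>' v"
  and wedge_scale_left: "wedge p q (\<lambda>v. c * \<alpha> v) \<beta> v = c * wedge p q \<alpha> \<beta> v"
  and wedge_scale_right: "wedge p q \<alpha> (\<lambda>v. c * \<beta> v) v = c * wedge p q \<alpha> \<beta> v"
  and wedge_zero_left: "wedge p q (\<lambda>v. 0) \<beta> v = 0"
  and wedge_zero_right: "wedge p q \<alpha> (\<lambda>v. 0) v = 0"
  by (simp_all add: wedge_def algebra_simps sum.distrib sum_distrib_left add_divide_distrib)

lemma wedge_sum_left:
  "wedge p q (\<lambda>v. \<Sum>x\<in>S. \<alpha> x v) \<beta> v = (\<Sum>x\<in>S. wedge p q (\<alpha> x) \<beta> v)"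
  by (induction S rule: infinite_finite_induct)
     (simp_all add: wedge_add_left wedge_zero_left)

lemma wedge_sum_right:
  "wedge p q \<alpha> (\<lambda>v. \<Sum>x\<in>S. \<beta> x v) v = (\<Sum>x\<in>S. wedge p q \<alpha> (\<beta> x) v)"
  by (induction S rule: infinite_finite_induct)
     (simp_all add: wedge_add_right wedge_zero_right)

lemma wedge_list_Cons_scale:
  assumes "\<And>v. wedge_list fs v = c * wedge_list gs v" and "length fs = length gs"
  shows "wedge_list (f # fs) v = c * wedge_list (f # gs) v"
proof -
  have "wedge_list (f # fs) v = wedge (length [f]) (length fs) (wedge_list [f]) (wedge_list fs) v"
    using wedge_wedge_list[of "[f]" fs] by simp
  also have "\<dots> = wedge (length [f]) (length gs) (wedge_list [f]) (\<lambda>v. c * wedge_list gs v) v"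
    using assms by presburger
  also have "\<dots> = c * wedge_list (f # gs) v"
    using wedge_wedge_list[of "[f]" gs] by (simp add: wedge_scale_right)
  finally show ?thesis .
qed

text \<open>Splitting off the first two forms by \<open>wedge_wedge_list\<close> reduces the
  exchange to degree two.\<close>

lemma wedge_list_swap: "wedge_list (f # g # fs) v = - wedge_list (g # f # fs) v"
proof -
  have swap2: "wedge_list [f, g] = (\<lambda>v. (- 1) * wedge_list [g, f] v)"
    by (simp add: fun_eq_iff wedge_list_2)
  have "wedge_list (f # g # fs) v = wedge (length [f, g]) (length fs) (wedge_list [f, g]) (wedge_list fs) v"
    using wedge_wedge_list[of "[f, g]" fs] by simp
  also have "\<dots> = wedge (length [g, f]) (length fs) (\<lambda>v. (- 1) * wedge_list [g, f] v) (wedge_list fs) v"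
    using swap2 by simp
  also have "\<dots> = - wedge_list (g # f # fs) v"
    using wedge_wedge_list[of "[g, f]" fs] by (subst wedge_scale_left) simp
  finally show ?thesis .
qed

lemma wedge_list_repeat: "wedge_list (f # f # fs) v = 0"
  using wedge_list_swap[of f f fs v] by simp

text \<open>Integer combinations of wedge products of members of a family \<open>e\<close> of 1-forms, given by the
  list of their coefficients and index lists. Identities between them are decided by sorting
  the index lists.\<close>

type_synonym comb = "(int \<times> nat list) list"

definition comb_form :: "(nat \<Rightarrow> 'e \<Rightarrow> real) \<Rightarrow> comb \<Rightarrow> 'e covector" where
  "comb_form e L v = (\<Sum>(c, I)\<leftarrow>L. of_int c * wedge_list (map e I) v)"

lemma comb_form_simps [simp]:
  "comb_form e [] v = 0"
  "comb_form e ((c, I) # L) v = of_int c * wedge_list (map e I) v + comb_form e L v"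
  "comb_form e (L @ L') v = comb_form e L v + comb_form e L' v"
  by (simp_all add: comb_form_def)

definition comb_of_length :: "nat \<Rightarrow> comb \<Rightarrow> bool" where
  "comb_of_length k L \<longleftrightarrow> (\<forall>(c, I)\<in>set L. length I = k)"

lemma comb_of_length_simps [simp]:
  "comb_of_length k []"
  "comb_of_length k ((c, I) # L) \<longleftrightarrow> length I = k \<and> comb_of_length k L"
  by (auto simp: comb_of_length_def)

definition comb_scale :: "int \<Rightarrow> comb \<Rightarrow> comb" where
  "comb_scale a L = map (\<lambda>(c, I). (a * c, I)) L"

lemma comb_form_scale: "comb_form e (comb_scale a L) v = of_int a * comb_form e L v"
  by (induction L) (auto simp: comb_scale_def algebra_simps)

definition comb_mult :: "comb \<Rightarrow> comb \<Rightarrow> comb" where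
  "comb_mult L M = concat (map (\<lambda>(c, I). map (\<lambda>(d, J). (c * d, I @ J)) M) L)"

lemma wedge_comb_form:
  assumes "comb_of_length p L" "comb_of_length q M"
  shows "wedge p q (comb_form e L) (comb_form e M) = comb_form e (comb_mult L M)"
proof
  fix v
  show "wedge p q (comb_form e L) (comb_form e M) v = comb_form e (comb_mult L M) v"
    using assms(1)
  proof (induction L)
    case Nil
    then show ?case
      by (simp add: comb_mult_def comb_form_def[abs_def] wedge_zero_left)
  next
    case (Cons x L)
    obtain c I where x: "x = (c, I)" by fastforce
    have I: "length I = p" and L: "comb_of_length p L"
      using Cons.prems by (auto simp: x)
    have one: "wedge p q (wedge_list (map e I)) (comb_form e N) v
        = comb_form e (map (\<lambda>(d, J). (d, I @ J)) N) v" if "comb_of_length q N" for N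
      using that
    proof (induction N)
      case Nil
      then show ?case
        by (simp add: comb_form_def[abs_def] wedge_zero_right)
    next
      case (Cons y N)
      obtain d J where y: "y = (d, J)" by fastforce
      have "wedge p q (wedge_list (map e I)) (wedge_list (map e J)) v = wedge_list (map e (I @ J)) v"
        using wedge_wedge_list[of "map e I" "map e J"] I Cons.prems by (simp add: y)
      then show ?case
        using Cons unfolding y comb_form_simps(2)[abs_def]
        by (simp add: wedge_add_right wedge_scale_right)
    qed
    have "comb_form e (map (\<lambda>(d, J). (c * d, I @ J)) M) v
        = of_int c * comb_form e (map (\<lambda>(d, J). (d, I @ J)) M) v"
      by (induction M) (auto simp: algebra_simps)
    then show ?case
      using Cons.IH[OF L] one[OF assms(2)] unfolding x comb_form_simps(2)[abs_def]
      by (simp add: wedge_add_left wedge_scale_left comb_mult_def)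
  qed
qed

text \<open>The sign of the sorting permutation, counted by inversions; it is 0 for a repeated
  index, where the product of forms vanishes.\<close>

fun index_sign :: "nat list \<Rightarrow> int" where
  "index_sign [] = 1"
| "index_sign (i # I) =
     (if i \<in> set I then 0 else (- 1) ^ length (filter (\<lambda>j. j < i) I) * index_sign I)"

text \<open>Moving \<open>e i\<close> to the right costs one sign for each smaller index it passes,
  and meeting an equal index kills the product.\<close>

lemma wedge_list_insort:
  fixes i :: nat
  assumes "sorted J"
  shows "wedge_list (e i # map e J) v =
    (if i \<in> set J then 0 else (- 1) ^ length (filter (\<lambda>j. j < i) J) * wedge_list (map e (insort i J)) v)"
  using assms
proof (induction J arbitrary: v)
  case Nil
  then show ?case by simp
next
  case (Cons j J)
  consider "i = j" | "i < j" | "i > j" by linarith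
  then show ?case
  proof cases
    case 1
    then show ?thesis by (simp add: wedge_list_repeat)
  next
    case 2
    then have "i \<notin> set J" "filter (\<lambda>j. j < i) J = []"
      using Cons.prems by (auto simp: filter_empty_conv)
    then show ?thesis using 2 by simp
  next
    case 3
    let ?c = "if i \<in> set J then 0 else (- 1) ^ length (filter (\<lambda>j. j < i) J) :: real"
    have IH: "wedge_list (e i # map e J) v = ?c * wedge_list (map e (insort i J)) v" for v
      using Cons by simp
    have "wedge_list (e i # map e (j # J)) v = - wedge_list (e j # e i # map e J) v"
      by (simp add: wedge_list_swap[of "e i"])
    also have "\<dots> = - (?c * wedge_list (e j # map e (insort i J)) v)"
      by (subst wedge_list_Cons_scale[OF IH]) simp_all
    finally show ?thesis using 3 by auto
  qed
qed

lemma wedge_list_sort: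
  "wedge_list (map e I) v = of_int (index_sign I) * wedge_list (map e (sort I)) v"
proof (induction I arbitrary: v)
  case (Cons i I)
  have "wedge_list (map e (i # I)) v = of_int (index_sign I) * wedge_list (e i # map e (sort I)) v"
    unfolding list.map by (rule wedge_list_Cons_scale[OF Cons]) simp
  moreover have "length (filter (\<lambda>j. j < i) (sort I)) = length (filter (\<lambda>j. j < i) I)"
    by (metis filter_sort length_sort)
  ultimately show ?case
    by (subst (asm) wedge_list_insort) auto
qed simp

fun comb_insert :: "int \<Rightarrow> nat list \<Rightarrow> comb \<Rightarrow> comb" where
  "comb_insert c I [] = [(c, I)]"
| "comb_insert c I ((d, J) # L) = (if I = J then (c + d, J) # L else (d, J) # comb_insert c I L)"

text \<open>Cancelled terms stay in the list with coefficient 0, which is why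
  \<open>comb_is_zero\<close> tests coefficients instead of emptiness.\<close>

definition comb_normalize :: "comb \<Rightarrow> comb" where
  "comb_normalize L =
     foldr (\<lambda>(c, I) M. let s = index_sign I in if s = 0 then M else comb_insert (c * s) (sort I) M) L []"

definition comb_is_zero :: "comb \<Rightarrow> bool" where
  "comb_is_zero L \<longleftrightarrow> list_all (\<lambda>(c, I). c = 0) (comb_normalize L)"

lemma comb_form_insert:
  "comb_form e (comb_insert c I L) v = of_int c * wedge_list (map e I) v + comb_form e L v"
  by (induction c I L rule: comb_insert.induct) (auto simp: algebra_simps)

lemma comb_form_normalize: "comb_form e (comb_normalize L) v = comb_form e L v"
proof (induction L)
  case (Cons x L)
  obtain c I where x: "x = (c, I)" by fastforce
  show ?case
    using Cons unfolding x comb_form_simps wedge_list_sort[of e I]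
    by (simp add: comb_normalize_def Let_def comb_form_insert)
qed (simp add: comb_normalize_def)

lemma comb_form_is_zero:
  assumes "comb_is_zero L"
  shows "comb_form e L v = 0"
proof -
  have "list_all (\<lambda>(c, I). c = 0) M \<Longrightarrow> comb_form e M v = 0" for M
    by (induction M) auto
  then show ?thesis
    using assms comb_form_normalize[of e L v] by (simp add: comb_is_zero_def)
qed

section \<open>The G2-form and its dual as integer combinations\<close>

definition G2_comb :: comb where
  "G2_comb = [(1, [1,2,3]), (-1, [1,4,5]), (-1, [1,6,7]), (-1, [2,4,6]), (-1, [2,7,5]),
     (-1, [3,4,7]), (-1, [3,5,6])]"

text \<open>The classical expression of the Hodge dual: e^4567 - e^23 (e^67 + e^45) - e^31 (e^75 +
  e^46) - e^12 (e^56 + e^47).\<close>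

definition G2_dual_comb :: comb where
  "G2_dual_comb = [(1, [4,5,6,7]), (-1, [2,3,6,7]), (-1, [2,3,4,5]), (-1, [3,1,7,5]),
     (-1, [3,1,4,6]), (-1, [1,2,5,6]), (-1, [1,2,4,7])]"

lemma triple_wedge_eq: "triple_wedge e i j k = wedge_list [e i, e j, e k]"
proof -
  have 1: "(\<lambda>v. e l (v 0)) = wedge_list [e l]" for l
    by (simp add: fun_eq_iff wedge_list_1)
  show ?thesis
    using wedge_wedge_list[of "[e i]" "[e j]"] wedge_wedge_list[of "[e i, e j]" "[e k]"]
    by (simp add: triple_wedge_def 1 numeral_2_eq_2)
qed

lemma standard_G2_form_eq: "standard_G2_form e = comb_form e G2_comb"
  by (simp add: fun_eq_iff standard_G2_form_def triple_wedge_eq G2_comb_def)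

text \<open>Interior product with the dual frame vector of index \<open>l\<close>: an occurrence of
  \<open>l\<close> at position \<open>j\<close> is deleted at the cost of the sign (-1)^j.\<close>

definition contract_index :: "nat \<Rightarrow> nat list \<Rightarrow> comb" where
  "contract_index l I = map (\<lambda>j. ((- 1) ^ j, take j I @ drop (Suc j) I))
     (filter (\<lambda>j. I ! j = l) [0..<length I])"

definition comb_contract :: "nat \<Rightarrow> comb \<Rightarrow> comb" where
  "comb_contract l L = concat (map (\<lambda>(c, I). comb_scale c (contract_index l I)) L)"

text \<open>The identity that defines the metric, on the 49 pairs of frame vectors: the resulting
  7-form is 6 times the volume form on the diagonal and 0 off it.\<close>

lemma G2_dual_volume_checks:
  "\<forall>l\<in>set [1..<8]. \<forall>m\<in>set [1..<8]. comb_is_zero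
     (comb_mult (comb_mult (comb_contract l G2_comb) (comb_contract m G2_comb)) G2_comb
      @ [(if l = m then - 6 else 0, [1..<8])])"
  by code_simp

text \<open>Evaluation on three dual frame vectors: \<open>d a n\<close> pairs the factor at
  position \<open>a\<close> with the frame vector of index \<open>n\<close>, so a product becomes a
  3 by 3 determinant of integers.\<close>

definition comb_eval3 :: "comb \<Rightarrow> nat \<Rightarrow> nat \<Rightarrow> nat \<Rightarrow> int" where
  "comb_eval3 L i j k = (\<Sum>(c, I)\<leftarrow>L.
     let d = (\<lambda>a n. if I ! a = n then 1 else 0) in
     c * (d 0 i * (d 1 j * d 2 k - d 1 k * d 2 j) - d 0 j * (d 1 i * d 2 k - d 1 k * d 2 i)
       + d 0 k * (d 1 i * d 2 j - d 1 j * d 2 i)))"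

text \<open>The identity that defines the Hodge star, for products of three coframe members. All 343
  triples are tested, repeated indices included, because the expansion of a 3-covector below sums
  over all index triples.\<close>

lemma G2_dual_wedge_checks:
  "\<forall>i\<in>set [1..<8]. \<forall>j\<in>set [1..<8]. \<forall>k\<in>set [1..<8]. comb_is_zero
     (comb_mult [(1, [i, j, k])] G2_dual_comb @ [(- comb_eval3 G2_comb i j k, [1..<8])])"
  by code_simp

section \<open>The algebra of a G2-form\<close>

text \<open>Any permutation other than the identity moves some index and so contributes a factor
  0.\<close>

lemma wedge_list_dual:
  assumes "\<And>i j. i < length fs \<Longrightarrow> j < length fs \<Longrightarrow> (fs ! i) (v j) = (if i = j then 1 else 0)"
  shows "wedge_list fs v = 1"
proof -
  have "(\<Prod>i<length fs. (fs ! i) (v (\<sigma> i))) = (if \<sigma> = id then 1 else 0)"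
    if \<sigma>: "\<sigma> permutes {..<length fs}" for \<sigma>
  proof -
    have less: "\<sigma> i < length fs" if "i < length fs" for i
      using permutes_in_image[OF \<sigma>] that by (metis lessThan_iff)
    show ?thesis
    proof (cases "\<sigma> = id")
      case False
      then obtain i where "\<sigma> i \<noteq> i" by fastforce
      moreover from this have "i < length fs"
        using permutes_not_in[OF \<sigma>] by (metis lessThan_iff)
      ultimately show ?thesis
        using False assms[of i "\<sigma> i"] less[of i] by (intro trans[OF prod_zero]) auto
    qed (simp add: assms)
  qed
  then have "wedge_list fs v
      = (\<Sum>\<sigma> | \<sigma> permutes {..<length fs}. if \<sigma> = id then 1 else 0)"
    unfolding wedge_list_def by (intro sum.cong refl) auto
  also have "\<dots> = 1"
    by (simp add: finite_permutations permutes_id)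
  finally show ?thesis .
qed

text \<open>Pairing with \<open>e j\<close> extracts the coefficient of \<open>b j\<close>, so the
  vectors are distinct and independent; by their number they span.\<close>

lemma dual_frame_expansion:
  fixes b :: "nat \<Rightarrow> 'e::euclidean_space"
  assumes fin: "finite I" and card: "card I = DIM('e)"
    and lin: "\<And>i. i \<in> I \<Longrightarrow> linear (e i)"
    and dual: "\<And>i j. i \<in> I \<Longrightarrow> j \<in> I \<Longrightarrow> e i (b j) = (if i = j then 1 else 0 :: real)"
  shows "x = (\<Sum>i\<in>I. e i x *\<^sub>R b i)"
proof -
  have coeff: "e j (\<Sum>i\<in>I. c i *\<^sub>R b i) = c j" if "j \<in> I" for c j
  proof -
    have "e j (\<Sum>i\<in>I. c i *\<^sub>R b i) = (\<Sum>i\<in>I. if j = i then c i else 0)"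
      using that by (simp add: linear_sum[OF lin[OF that]] linear_scale[OF lin[OF that]] dual
          if_distrib[of "(*) _"] cong: if_cong)
    then show ?thesis using that fin by simp
  qed
  have inj: "inj_on b I"
    using dual by (metis inj_onI zero_neq_one)
  have "independent (b ` I)"
    unfolding independent_explicit_finite_subsets
  proof (intro allI impI ballI)
    fix S u v assume S: "S \<subseteq> b ` I" "finite S" "(\<Sum>v\<in>S. u v *\<^sub>R v) = 0" and v: "v \<in> S"
    \<comment> \<open>The coefficients are extended by 0 to the whole frame, so that
      \<open>coeff\<close> applies.\<close>
    define c where "c i = (if b i \<in> S then u (b i) else 0)" for i
    have "(\<Sum>i\<in>I. c i *\<^sub>R b i) = (\<Sum>v\<in>b ` I. (if v \<in> S then u v else 0) *\<^sub>R v)"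
      using inj by (simp add: sum.reindex c_def)
    also have "\<dots> = (\<Sum>v\<in>S. u v *\<^sub>R v)"
      using S fin by (intro sum.mono_neutral_cong_right) auto
    finally have "(\<Sum>i\<in>I. c i *\<^sub>R b i) = 0" using S by simp
    moreover obtain j where j: "j \<in> I" "v = b j" using v S by auto
    moreover have "e j 0 = 0" using lin[OF j(1)] by (rule linear_0)
    ultimately have "c j = 0" using coeff[of j c] by simp
    then show "u v = 0" using j v by (simp add: c_def)
  qed
  moreover have "card (b ` I) = DIM('e)"
    using inj card by (simp add: card_image)
  ultimately have "span (b ` I) = UNIV"
    using card_eq_dim[of "b ` I" UNIV] fin by (auto simp: dim_UNIV)
  then have "x \<in> span (b ` I)" by simp
  then obtain u where "x = (\<Sum>v\<in>b ` I. u v *\<^sub>R v)"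
    using fin by (auto simp: span_finite)
  then have "x = (\<Sum>i\<in>I. u (b i) *\<^sub>R b i)"
    using inj by (simp add: sum.reindex)
  moreover from this have "e i x = u (b i)" if "i \<in> I" for i
    using coeff[OF that, of "\<lambda>i. u (b i)"] by simp
  ultimately show ?thesis by simp
qed

lemma kcovector_cong: "kcovector k \<alpha> \<Longrightarrow> (\<And>i. i < k \<Longrightarrow> v i = w i) \<Longrightarrow> \<alpha> v = \<alpha> w"
  and kcovector_linear: "kcovector k \<alpha> \<Longrightarrow> i < k \<Longrightarrow> linear (\<lambda>x. \<alpha> (v(i := x)))"
  and kcovector_alternating:
    "kcovector k \<alpha> \<Longrightarrow> i < k \<Longrightarrow> j < k \<Longrightarrow> i \<noteq> j \<Longrightarrow> v i = v j \<Longrightarrow> \<alpha> v = 0"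
  unfolding kcovector_def by meson+

lemma comb_of_length_contract:
  assumes "comb_of_length (Suc k) L"
  shows "comb_of_length k (comb_contract l L)"
proof -
  have "length J = k" if "(c, J) \<in> set (comb_scale d (contract_index l I))" "length I = Suc k" for c d I J
    using that by (auto simp: comb_scale_def contract_index_def simp del: upt_Suc)
  then show ?thesis
    using assms unfolding comb_of_length_def comb_contract_def by fastforce
qed

lemma comb_of_length_mult:
  assumes "comb_of_length p L" "comb_of_length q M"
  shows "comb_of_length (p + q) (comb_mult L M)"
  using assms by (fastforce simp: comb_of_length_def comb_mult_def)

lemma atLeastAtMost_1_7: "{1..7} = set [1..<8 :: nat]"
  by auto

lemma sum_1_7: "(\<Sum>i=1..7. f i) = f 1 + f 2 + f 3 + f 4 + f 5 + f 6 + f (7::nat)"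
  by (simp add: eval_nat_numeral)

lemma sum_PiE_lessThan_3:
  fixes S :: "'a set"
  shows "(\<Sum>f\<in>{..<3::nat} \<rightarrow>\<^sub>E S. F (f 0) (f 1) (f 2)) = (\<Sum>i\<in>S. \<Sum>j\<in>S. \<Sum>k\<in>S. F i j k)"
proof -
  have "(\<Sum>f\<in>{..<3::nat} \<rightarrow>\<^sub>E S. F (f 0) (f 1) (f 2)) = (\<Sum>(i, j, k)\<in>S \<times> S \<times> S. F i j k)"
  proof (rule sum.reindex_bij_witness[of _
        "\<lambda>(i, j, k). \<lambda>n\<in>{..<3}. if n = 0 then i else if n = 1 then j else k" "\<lambda>f. (f 0, f 1, f 2)"])
    fix f :: "nat \<Rightarrow> 'a" assume f: "f \<in> {..<3} \<rightarrow>\<^sub>E S"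
    have *: "(if n = 0 then f 0 else if n = 1 then f 1 else f 2) = f n" if "n < 3" for n
    proof -
      have "n = 0 \<or> n = 1 \<or> n = 2" using that by linarith
      then show ?thesis by auto
    qed
    have "f \<in> extensional {..<3}"
      using f by (simp add: PiE_def)
    then show "(case (f 0, f 1, f 2) of (i, j, k) \<Rightarrow>
        \<lambda>n\<in>{..<3}. if n = 0 then i else if n = 1 then j else k) = f"
      by (intro extensionalityI[of _ "{..<3}"]) (simp_all only: prod.case restrict_extensional restrict_apply' lessThan_iff * split: prod.split)
    show "(f 0, f 1, f 2) \<in> S \<times> S \<times> S"
      using PiE_mem[OF f, of 0] PiE_mem[OF f, of 1] PiE_mem[OF f, of 2] by simp
  qed (auto split: if_splits)
  then show ?thesis by (simp add: sum.cartesian_product)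
qed

section \<open>Metric, volume form and Hodge star of a coframe\<close>

definition coframe_metric :: "(nat \<Rightarrow> 'e \<Rightarrow> real) \<Rightarrow> 'e \<Rightarrow> 'e \<Rightarrow> real" where
  "coframe_metric e x y = (\<Sum>i=1..7. e i x * e i y)"

text \<open>Carrying an explicit dual frame along makes the metric orthonormal by construction and
  spares any matrix inversion.\<close>

locale dual_coframe =
  fixes e :: "nat \<Rightarrow> real ^ 7 \<Rightarrow> real" and b :: "nat \<Rightarrow> real ^ 7"
  assumes linear_coframe: "i \<in> {1..7} \<Longrightarrow> linear (e i)"
    and dual: "i \<in> {1..7} \<Longrightarrow> j \<in> {1..7} \<Longrightarrow> e i (b j) = (if i = j then 1 else 0)"
begin

abbreviation metric :: "real ^ 7 \<Rightarrow> real ^ 7 \<Rightarrow> real" where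
  "metric \<equiv> coframe_metric e"

text \<open>Orthonormal frames are numbered from 0, coframes from 1.\<close>

definition frame :: "nat \<Rightarrow> real ^ 7" where
  "frame i = b (Suc i)"

lemma expansion: "x = (\<Sum>i=1..7. e i x *\<^sub>R b i)"
  by (rule dual_frame_expansion) (simp_all only: linear_coframe dual, simp_all)

lemma coframe: "coframe e"
  unfolding coframe_def
proof (intro conjI ballI allI impI)
  fix a i assume "\<forall>x. (\<Sum>i=1..7. a i * e i x) = 0" and i: "i \<in> {1..7::nat}"
  then have "0 = (\<Sum>j=1..7. a j * e j (b i))" by metis
  also have "\<dots> = (\<Sum>j=1..7. if j = i then a j else 0)"
    using i by (intro sum.cong refl) (simp add: dual)
  also have "\<dots> = a i" using i by simp
  finally show "a i = 0" by simp
qed (use linear_coframe in auto)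

lemma inner_product_form_metric: "inner_product_form metric"
proof -
  have bil: "bilinear metric"
    unfolding bilinear_def coframe_metric_def
  proof (intro conjI allI)
    fix x
    have lin: "linear (\<lambda>y. e i x * e i y)" if "i \<in> {1..7}" for i
      using linear_compose_scale_right[OF linear_coframe[OF that], of "e i x"] by simp
    show "linear (\<lambda>y. \<Sum>i=1..7. e i x * e i y)"
      using lin by (intro linear_compose_sum) auto
    then show "linear (\<lambda>y. \<Sum>i=1..7. e i y * e i x)"
      by (simp only: mult.commute)
  qed
  have "metric x x > 0" if "x \<noteq> 0" for x
  proof -
    have "\<exists>i\<in>{1..7}. e i x \<noteq> 0"
    proof (rule ccontr)
      assume "\<not> (\<exists>i\<in>{1..7}. e i x \<noteq> 0)"
      then have "(\<Sum>i=1..7. e i x *\<^sub>R b i) = 0" by (intro sum.neutral) auto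
      then show False using expansion[of x] that by argo
    qed
    then obtain i where i: "i \<in> {1..7}" "e i x \<noteq> 0" by blast
    then show ?thesis
      unfolding coframe_metric_def by (intro sum_pos2[of _ i]) (auto simp: zero_less_mult_iff)
  qed
  with bil show ?thesis
    by (simp add: inner_product_form_def coframe_metric_def mult.commute)
qed

lemma orthonormal_frame_metric: "orthonormal_frame metric frame"
  unfolding orthonormal_frame_def
proof (intro allI impI)
  fix i j assume "i < DIM(real ^ 7)" "j < DIM(real ^ 7)"
  then have ij: "Suc i \<in> {1..7}" "Suc j \<in> {1..7}" by auto
  have "metric (frame i) (frame j) = (\<Sum>l=1..7. if l = Suc i then (if l = Suc j then 1 else 0) else 0)"
    unfolding coframe_metric_def frame_def using ij by (intro sum.cong refl) (simp add: dual)
  also have "\<dots> = (if i = j then 1 else 0)" using ij by simp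
  finally show "metric (frame i) (frame j) = (if i = j then 1 else 0)" .
qed

lemma kcovector_wedge_list_coframe:
  assumes "set I \<subseteq> {1..7}"
  shows "kcovector (length I) (wedge_list (map e I))"
proof -
  have "linear f" if "f \<in> set (map e I)" for f
    using that assms linear_coframe by auto
  from kcovector_wedge_list[of "map e I", OF this] show ?thesis by simp
qed

lemma volume_form_of_metric: "volume_form_of metric (wedge_list (map e [1..<8]))"
  unfolding volume_form_of_def
proof (intro conjI exI[of _ frame] orthonormal_frame_metric)
  show "kcovector DIM(real ^ 7) (wedge_list (map e [1..<8]))"
    using kcovector_wedge_list_coframe[of "[1..<8]"] by (simp add: subset_iff)
  show "wedge_list (map e [1..<8]) frame = 1"
    by (rule wedge_list_dual) (simp add: frame_def dual del: upt_Suc)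
qed

lemma interior_prod_G2:
  "interior_prod X (comb_form e G2_comb) v
    = (\<Sum>l=1..7. e l X * comb_form e (comb_contract l G2_comb) v)"
  unfolding interior_prod_def sum_1_7
  by (simp add: G2_comb_def comb_contract_def contract_index_def comb_scale_def wedge_list_3 wedge_list_2
      eval_nat_numeral) (simp add: algebra_simps)

text \<open>Both contractions are expanded in the frame. Bilinearity leaves the products of
  \<open>G2_dual_volume_checks\<close>, whose diagonal members add up to the metric.\<close>

lemma G2_metric_identity:
  "6 * metric X Y * wedge_list (map e [1..<8]) v =
    wedge 4 3 (wedge 2 2 (interior_prod X (comb_form e G2_comb)) (interior_prod Y (comb_form e G2_comb)))
      (comb_form e G2_comb) v"
proof -
  let ?\<phi> = "comb_form e G2_comb" and ?c = "\<lambda>l. comb_contract l G2_comb"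
  let ?vol = "wedge_list (map e [1..<8])"
  have len3: "comb_of_length 3 G2_comb" by (simp add: G2_comb_def)
  then have len2: "comb_of_length 2 (?c l)" for l
    by (intro comb_of_length_contract) (simp add: eval_nat_numeral)
  then have len4: "comb_of_length 4 (comb_mult (?c l) (?c m))" for l m
    using comb_of_length_mult[OF len2 len2] by simp
  have *: "comb_form e (comb_mult (comb_mult (?c l) (?c m)) G2_comb) v = (if l = m then 6 else 0) * ?vol v"
    if "l \<in> {1..7}" "m \<in> {1..7}" for l m
    using G2_dual_volume_checks[THEN bspec, THEN bspec, of l m, THEN comb_form_is_zero, of e v] that
    unfolding atLeastAtMost_1_7 by (simp del: upt_Suc upt_rec split: if_splits)
  have ip: "interior_prod Z ?\<phi> = (\<lambda>v. \<Sum>l=1..7. e l Z * comb_form e (?c l) v)" for Z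
    by (rule ext) (rule interior_prod_G2)
  have "wedge 2 2 (interior_prod X ?\<phi>) (interior_prod Y ?\<phi>)
      = wedge 2 2 (\<lambda>v. \<Sum>l=1..7. e l X * comb_form e (?c l) v) (\<lambda>v. \<Sum>m=1..7. e m Y * comb_form e (?c m) v)"
    by (rule arg_cong2[OF ip ip])
  also have "\<dots> = (\<lambda>v. \<Sum>l=1..7. e l X * (\<Sum>m=1..7. e m Y * comb_form e (comb_mult (?c l) (?c m)) v))"
    by (rule ext) (simp only: wedge_sum_left wedge_scale_left wedge_sum_right wedge_scale_right wedge_comb_form[OF len2 len2])
  finally have "wedge 4 3 (wedge 2 2 (interior_prod X ?\<phi>) (interior_prod Y ?\<phi>)) ?\<phi> v
      = wedge 4 3 (\<lambda>v. \<Sum>l=1..7. e l X * (\<Sum>m=1..7. e m Y * comb_form e (comb_mult (?c l) (?c m)) v)) ?\<phi> v"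
    by (rule arg_cong)
  also have "\<dots> = (\<Sum>l=1..7. e l X * (\<Sum>m=1..7. e m Y * comb_form e (comb_mult (comb_mult (?c l) (?c m)) G2_comb) v))"
    by (simp only: wedge_sum_left wedge_scale_left wedge_comb_form[OF len4 len3])
  also have "\<dots> = (\<Sum>l=1..7. e l X * (\<Sum>m=1..7. if l = m then e m Y * (6 * ?vol v) else 0))"
    by (intro sum.cong refl arg_cong2[where f = "(*)"]) (simp only: *, simp)
  also have "\<dots> = (\<Sum>l=1..7. e l X * (e l Y * (6 * ?vol v)))"
    by (intro sum.cong refl arg_cong2[where f = "(*)"]) (simp only: sum.delta' finite_atLeastAtMost if_True)
  also have "\<dots> = 6 * metric X Y * ?vol v"
    unfolding coframe_metric_def sum_distrib_left sum_distrib_right by (intro sum.cong refl) (simp only: mult_ac)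
  finally show ?thesis ..
qed

text \<open>A trilinear expansion in the frame is antisymmetrised: each of the six terms of the 3 by
  3 determinant contributes the value of \<open>\<gamma>\<close> on \<open>v\<close>, which accounts
  for the division by 6.\<close>

lemma kcovector_3_expansion:
  assumes \<gamma>: "kcovector 3 \<gamma>"
  shows "\<gamma> v = (\<Sum>f\<in>{..<3} \<rightarrow>\<^sub>E {..<7}. \<gamma> (\<lambda>i. frame (f i))
    * wedge_list [e (Suc (f 0)), e (Suc (f 1)), e (Suc (f 2))] v) / 6"
proof -
  define T where "T x y z = \<gamma> (\<lambda>n. if n = 0 then x else if n = 1 then y else z)" for x y z
  have \<gamma>_T: "\<gamma> w = T (w 0) (w 1) (w 2)" for w
    unfolding T_def by (rule kcovector_cong[OF \<gamma>]) (auto simp: less_Suc_eq numeral_3_eq_3 numeral_2_eq_2)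
  have lin: "linear (\<lambda>x. T x y z)" "linear (\<lambda>y. T x y z)" "linear (\<lambda>z. T x y z)" for x y z
    using kcovector_linear[OF \<gamma>, of 0 "\<lambda>n. if n = 1 then y else z"]
      kcovector_linear[OF \<gamma>, of 1 "\<lambda>n. if n = 0 then x else z"]
      kcovector_linear[OF \<gamma>, of 2 "\<lambda>n. if n = 0 then x else y"]
    unfolding \<gamma>_T by simp_all
  have alt: "T x x z = 0" "T x y y = 0" "T x y x = 0" for x y z
    unfolding T_def
    by (rule kcovector_alternating[OF \<gamma>, of 0 1], simp_all)
       (rule kcovector_alternating[OF \<gamma>, of 1 2], simp_all,
        rule kcovector_alternating[OF \<gamma>, of 0 2], simp_all)
  have add: "T (x + x') y z = T x y z + T x' y z" "T x (y + y') z = T x y z + T x y' z"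
      "T x y (z + z') = T x y z + T x y z'" for x x' y y' z z'
    by (rule linear_add[OF lin(1)] linear_add[OF lin(2)] linear_add[OF lin(3)])+
  \<comment> \<open>Antisymmetry, from expanding the vanishing value on a repeated sum.\<close>
  have swap: "T x y z = - T y x z" "T x y z = - T x z y" for x y z
  proof -
    have "T (x + y) (x + y) z = T x x z + T x y z + (T y x z + T y y z)"
      by (simp only: add)
    then show "T x y z = - T y x z" by (simp add: alt)
    have "T x (y + z) (y + z) = T x y y + T x y z + (T x z y + T x z z)"
      by (simp only: add)
    then show "T x y z = - T x z y" by (simp add: alt)
  qed
  have expand: "T x y z = (\<Sum>i=1..7. \<Sum>j=1..7. \<Sum>k=1..7. T (b i) (b j) (b k) * (e i x * (e j y * e k z)))"
    for x y z
  proof -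
    have 1: "T x y z = (\<Sum>i=1..7. e i x * T (b i) y z)" for x y z
    proof -
      have "T x y z = T (\<Sum>i=1..7. e i x *\<^sub>R b i) y z"
        by (rule arg_cong[OF expansion, of "\<lambda>x. T x y z"])
      then show ?thesis
        by (simp only: linear_sum[OF lin(1)] linear_scale[OF lin(1)] real_scaleR_def)
    qed
    have 2: "T x y z = (\<Sum>i=1..7. e i y * T x (b i) z)" for x y z
    proof -
      have "T x y z = T x (\<Sum>i=1..7. e i y *\<^sub>R b i) z"
        by (rule arg_cong[OF expansion, of "\<lambda>y. T x y z"])
      then show ?thesis
        by (simp only: linear_sum[OF lin(2)] linear_scale[OF lin(2)] real_scaleR_def)
    qed
    have 3: "T x y z = (\<Sum>i=1..7. e i z * T x y (b i))" for x y z
    proof -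
      have "T x y z = T x y (\<Sum>i=1..7. e i z *\<^sub>R b i)"
        by (rule arg_cong[OF expansion, of "\<lambda>z. T x y z"])
      then show ?thesis
        by (simp only: linear_sum[OF lin(3)] linear_scale[OF lin(3)] real_scaleR_def)
    qed
    have "T x y z = (\<Sum>i=1..7. e i x * T (b i) y z)" by (rule 1)
    also have "\<dots> = (\<Sum>i=1..7. e i x * (\<Sum>j=1..7. e j y * T (b i) (b j) z))"
      by (intro sum.cong refl arg_cong2[where f = "(*)"] 2)
    also have "\<dots> = (\<Sum>i=1..7. e i x * (\<Sum>j=1..7. e j y * (\<Sum>k=1..7. e k z * T (b i) (b j) (b k))))"
      by (intro sum.cong refl arg_cong2[where f = "(*)"] 3)
    finally have "T x y z = (\<Sum>i=1..7. e i x * (\<Sum>j=1..7. e j y * (\<Sum>k=1..7. e k z * T (b i) (b j) (b k))))" .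
    then show ?thesis by (simp only: sum_distrib_left mult_ac)
  qed
  let ?S = "\<lambda>x y z. \<Sum>i=1..7. \<Sum>j=1..7. \<Sum>k=1..7. T (b i) (b j) (b k) * (e i x * (e j y * e k z))"
  have "(\<Sum>f\<in>{..<3} \<rightarrow>\<^sub>E {..<7}. \<gamma> (\<lambda>i. frame (f i))
      * wedge_list [e (Suc (f 0)), e (Suc (f 1)), e (Suc (f 2))] v)
    = (\<Sum>i<7. \<Sum>j<7. \<Sum>k<7. T (b (Suc i)) (b (Suc j)) (b (Suc k)) * wedge_list [e (Suc i), e (Suc j), e (Suc k)] v)"
    unfolding \<gamma>_T frame_def by (rule sum_PiE_lessThan_3)
  also have "\<dots> = (\<Sum>i=1..7. \<Sum>j=1..7. \<Sum>k=1..7. T (b i) (b j) (b k) * wedge_list [e i, e j, e k] v)"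
    by (simp only: One_nat_def sum.atLeast1_atMost_eq)
  also have "\<dots> = ?S (v 0) (v 1) (v 2) - ?S (v 0) (v 2) (v 1) - ?S (v 1) (v 0) (v 2) + ?S (v 2) (v 0) (v 1)
      + ?S (v 1) (v 2) (v 0) - ?S (v 2) (v 1) (v 0)"
    unfolding wedge_list_3 by (simp only: sum_subtractf[symmetric] sum.distrib[symmetric])
       (intro sum.cong refl, simp add: algebra_simps)
  also have "\<dots> = 6 * T (v 0) (v 1) (v 2)"
    unfolding expand[symmetric]
    using swap[of "v 0" "v 1" "v 2"] swap[of "v 0" "v 2" "v 1"] swap[of "v 1" "v 0" "v 2"]
      swap[of "v 1" "v 2" "v 0"] swap[of "v 2" "v 0" "v 1"] swap[of "v 2" "v 1" "v 0"] by linarith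
  finally show ?thesis by (simp add: \<gamma>_T[of v])
qed

lemma comb_form_frame_3:
  assumes "\<forall>(c, I)\<in>set L. length I = 3 \<and> set I \<subseteq> {1..7}" and "i < 7" "j < 7" "k < 7"
  shows "comb_form e L (\<lambda>n. frame (if n = 0 then i else if n = 1 then j else k))
    = of_int (comb_eval3 L (Suc i) (Suc j) (Suc k))"
  using assms(1)
proof (induction L)
  case Nil
  then show ?case by (simp add: comb_eval3_def)
next
  case (Cons x L)
  obtain c I where x: "x = (c, I)" by fastforce
  then have "length I = 3" and sub: "set I \<subseteq> {1..7}" using Cons.prems by auto
  then obtain l m n where I: "I = [l, m, n]"
    by (auto simp: numeral_3_eq_3 length_Suc_conv)
  have "e a (frame h) = of_int (if a = Suc h then 1 else 0)" if "a \<in> set I" "h < 7" for a h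
    using that sub by (auto simp: frame_def dual subset_iff)
  then have "wedge_list (map e I) (\<lambda>n. frame (if n = 0 then i else if n = 1 then j else k))
      = of_int (comb_eval3 [(1, I)] (Suc i) (Suc j) (Suc k))"
    using assms(2-4) unfolding comb_eval3_def I
    by (simp add: wedge_list_3 Let_def del: of_int_1 of_int_0 split del: if_split)
  moreover have "comb_eval3 (x # L) (Suc i) (Suc j) (Suc k)
      = c * comb_eval3 [(1, I)] (Suc i) (Suc j) (Suc k) + comb_eval3 L (Suc i) (Suc j) (Suc k)"
    by (simp add: comb_eval3_def x Let_def split del: if_split)
  ultimately show ?case
    using Cons by (simp add: x)
qed

lemma kcovector_comb_form:
  assumes "\<forall>(c, I)\<in>set L. length I = k \<and> set I \<subseteq> {1..7}"
  shows "kcovector k (comb_form e L)"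
proof -
  have add: "kcovector k (\<lambda>v. c * \<alpha> v + \<beta> v)" if "kcovector k \<alpha>" "kcovector k \<beta>"
    for k c and \<alpha> \<beta> :: "(real ^ 7) covector"
    unfolding kcovector_def
  proof (intro conjI allI impI)
    fix v w :: "nat \<Rightarrow> real ^ 7" assume "\<forall>i<k. v i = w i"
    then have "\<alpha> v = \<alpha> w" "\<beta> v = \<beta> w"
      by (auto intro: kcovector_cong[OF that(1)] kcovector_cong[OF that(2)])
    then show "c * \<alpha> v + \<beta> v = c * \<alpha> w + \<beta> w" by simp
  next
    fix v i assume "i < k"
    then have "linear (\<lambda>x. \<alpha> (v(i := x)))" "linear (\<lambda>x. \<beta> (v(i := x)))"
      by (auto intro: kcovector_linear[OF that(1)] kcovector_linear[OF that(2)])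
    then show "linear (\<lambda>x. c * \<alpha> (v(i := x)) + \<beta> (v(i := x)))"
      by (simp add: linear_iff algebra_simps)
  next
    fix v :: "nat \<Rightarrow> real ^ 7" and i j assume "i < k" "j < k" "i \<noteq> j" "v i = v j"
    then have "\<alpha> v = 0" "\<beta> v = 0"
      by (auto intro: kcovector_alternating[OF that(1)] kcovector_alternating[OF that(2)])
    then show "c * \<alpha> v + \<beta> v = 0" by simp
  qed
  show ?thesis
    using assms
  proof (induction L)
    case Nil
    then show ?case by (simp add: kcovector_def comb_form_def linear_zero)
  next
    case (Cons x L)
    obtain c I where x: "x = (c, I)" by fastforce
    have "kcovector k (wedge_list (map e I))"
      using kcovector_wedge_list_coframe[of I] Cons.prems by (simp add: x)
    moreover have "kcovector k (comb_form e L)"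
      using Cons by simp
    moreover have "comb_form e (x # L) = (\<lambda>v. of_int c * wedge_list (map e I) v + comb_form e L v)"
      by (simp add: fun_eq_iff x)
    ultimately show ?case using add by presburger
  qed
qed

text \<open>Both sides are linear in the test covector, so its expansion reduces the claim to
  products of three coframe members, that is, to \<open>G2_dual_wedge_checks\<close>. The factor 1 /
  6 of the expansion is the division by \<open>fact 3\<close> in
  \<open>covector_inner\<close>.\<close>

lemma is_hodge_star_G2:
  "is_hodge_star metric (wedge_list (map e [1..<8])) 3 (comb_form e G2_comb) (comb_form e G2_dual_comb)"
  unfolding is_hodge_star_def
proof (intro conjI exI[of _ frame] orthonormal_frame_metric allI impI)
  show "kcovector (DIM(real ^ 7) - 3) (comb_form e G2_dual_comb)"
    using kcovector_comb_form[of G2_dual_comb 4] by (simp add: G2_dual_comb_def)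
next
  fix \<gamma> :: "(real ^ 7) covector" and v
  assume \<gamma>: "kcovector 3 \<gamma>"
  let ?vol = "wedge_list (map e [1..<8])"
  let ?w = "\<lambda>f. wedge_list [e (Suc (f 0)), e (Suc (f 1)), e (Suc (f 2 :: nat))]"
  have pt: "wedge 3 4 (?w f) (comb_form e G2_dual_comb) v = comb_form e G2_comb (\<lambda>i. frame (f i)) * ?vol v"
    if "f \<in> {..<3} \<rightarrow>\<^sub>E {..<7}" for f
  proof -
    have f: "f 0 < 7" "f 1 < 7" "f 2 < 7" using that by (auto simp: PiE_iff)
    then have mem: "Suc (f 0) \<in> set [1..<8]" "Suc (f 1) \<in> set [1..<8]" "Suc (f 2) \<in> set [1..<8]" by auto
    have "comb_form e G2_comb (\<lambda>i. frame (f i))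
        = comb_form e G2_comb (\<lambda>n. frame (if n = 0 then f 0 else if n = 1 then f 1 else f 2))"
      by (simp add: G2_comb_def wedge_list_3)
    also have "\<dots> = of_int (comb_eval3 G2_comb (Suc (f 0)) (Suc (f 1)) (Suc (f 2)))"
      using f by (intro comb_form_frame_3) (auto simp: G2_comb_def)
    finally have 1: "comb_form e G2_comb (\<lambda>i. frame (f i)) = \<dots>" .
    have "?w f = comb_form e [(1, [Suc (f 0), Suc (f 1), Suc (f 2)])]"
      by (simp add: fun_eq_iff)
    then have "wedge 3 4 (?w f) (comb_form e G2_dual_comb)
        = comb_form e (comb_mult [(1, [Suc (f 0), Suc (f 1), Suc (f 2)])] G2_dual_comb)"
      by (simp only:) (rule wedge_comb_form, simp_all add: G2_dual_comb_def)
    moreover have "comb_form e (comb_mult [(1, [Suc (f 0), Suc (f 1), Suc (f 2)])] G2_dual_comb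
        @ [(- comb_eval3 G2_comb (Suc (f 0)) (Suc (f 1)) (Suc (f 2)), [1..<8])]) v = 0"
      using G2_dual_wedge_checks mem by (intro comb_form_is_zero) blast
    ultimately show ?thesis by (simp add: 1 del: upt_Suc)
  qed
  have "\<gamma> = (\<lambda>v. \<Sum>f\<in>{..<3} \<rightarrow>\<^sub>E {..<7}. (\<gamma> (\<lambda>i. frame (f i)) / 6) * ?w f v)"
    by (rule ext) (subst kcovector_3_expansion[OF \<gamma>], simp add: sum_divide_distrib)
  then have "wedge 3 4 \<gamma> (comb_form e G2_dual_comb) v = wedge 3 4
      (\<lambda>v. \<Sum>f\<in>{..<3} \<rightarrow>\<^sub>E {..<7}. (\<gamma> (\<lambda>i. frame (f i)) / 6) * ?w f v) (comb_form e G2_dual_comb) v"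
    by (rule arg_cong)
  also have "\<dots> = (\<Sum>f\<in>{..<3} \<rightarrow>\<^sub>E {..<7}. (\<gamma> (\<lambda>i. frame (f i)) / 6) * wedge 3 4 (?w f) (comb_form e G2_dual_comb) v)"
    by (simp only: wedge_sum_left wedge_scale_left)
  also have "\<dots> = (\<Sum>f\<in>{..<3} \<rightarrow>\<^sub>E {..<7}. (\<gamma> (\<lambda>i. frame (f i)) / 6) *
      (comb_form e G2_comb (\<lambda>i. frame (f i)) * ?vol v))"
    by (intro sum.cong refl) (simp only: pt)
  also have "\<dots> = covector_inner frame 3 \<gamma> (comb_form e G2_comb) * ?vol v"
    by (simp add: covector_inner_def sum_distrib_right sum_distrib_left sum_divide_distrib fact_numeral mult_ac del: upt_Suc)
  finally show "wedge 3 (DIM(real ^ 7) - 3) \<gamma> (comb_form e G2_dual_comb) v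
      = covector_inner frame 3 \<gamma> (comb_form e G2_comb) * ?vol v"
    by simp
qed

end

section \<open>Smooth functions\<close>

lemma frechet_derivativeI: "(f has_derivative f') (at x) \<Longrightarrow> frechet_derivative f (at x) = f'"
  by (rule frechet_derivative_at [symmetric])

lemma C_on_cong:
  assumes "open S" and "\<And>x. x \<in> S \<Longrightarrow> f x = g x"
  shows "C_on k f S \<longleftrightarrow> C_on k g S"
  using assms(2)
proof (induction k arbitrary: f g)
  case 0
  then show ?case by (simp cong: continuous_on_cong)
next
  case (Suc k)
  have iff: "(f has_derivative f') (at x) \<longleftrightarrow> (g has_derivative f') (at x)" if "x \<in> S" for f' x
    using has_derivative_transform_within_open[OF _ assms(1) that, of f f' UNIV g]
      has_derivative_transform_within_open[OF _ assms(1) that, of g f' UNIV f] Suc.prems by auto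
  then have "frechet_derivative f (at x) = frechet_derivative g (at x)"
      "f differentiable (at x) \<longleftrightarrow> g differentiable (at x)" if "x \<in> S" for x
    using that by (simp_all add: frechet_derivative_def differentiable_def)
  moreover from this have "C_on k (\<lambda>x. frechet_derivative f (at x) b) S
      \<longleftrightarrow> C_on k (\<lambda>x. frechet_derivative g (at x) b) S" for b
    by (intro Suc.IH) simp
  ultimately show ?case by simp
qed

lemma C_on_SucI:
  assumes "open S" and "\<And>x. x \<in> S \<Longrightarrow> (f has_derivative f' x) (at x)"
    and "\<And>b. b \<in> Basis \<Longrightarrow> C_on k (\<lambda>x. f' x b) S"
  shows "C_on (Suc k) f S"
proof -
  have "C_on k (\<lambda>x. frechet_derivative f (at x) b) S" if "b \<in> Basis" for b
    using assms(3)[OF that] frechet_derivativeI[OF assms(2)]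
    by (subst C_on_cong[OF assms(1), of _ "\<lambda>x. f' x b"]) auto
  then show ?thesis
    using assms(2) by (auto simp: differentiable_def)
qed

lemma C_on_SucD: "C_on (Suc k) f S \<Longrightarrow> C_on k f S"
proof (induction k arbitrary: f)
  case 0
  then show ?case
    by (auto intro!: continuous_at_imp_continuous_on differentiable_imp_continuous_within)
next
  case (Suc k)
  from Suc.prems have "\<forall>x\<in>S. f differentiable (at x)"
      and "C_on (Suc k) (\<lambda>x. frechet_derivative f (at x) b) S" if "b \<in> Basis" for b
    using that C_on.simps(2)[of "Suc k" f S] by blast+
  then show ?case
    using Suc.IH by (metis C_on.simps(2) Suc.prems)
qed

lemma C_on_const: "C_on k (\<lambda>x. c) S"
proof (induction k arbitrary: c)
  case (Suc k)
  then show ?case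
    by (simp add: frechet_derivativeI[OF has_derivative_const])
qed simp

lemma C_on_has_derivative:
  "C_on (Suc k) f S \<Longrightarrow> x \<in> S \<Longrightarrow> (f has_derivative frechet_derivative f (at x)) (at x)"
  by (simp add: frechet_derivative_works)

lemma C_on_add:
  assumes "open S" "C_on k f S" "C_on k g S"
  shows "C_on k (\<lambda>x. f x + g x) S"
  using assms(2,3)
proof (induction k arbitrary: f g)
  case 0
  then show ?case by (simp add: continuous_on_add)
next
  case (Suc k)
  show ?case
    by (rule C_on_SucI[OF assms(1)
          has_derivative_add[OF C_on_has_derivative[OF Suc.prems(1)] C_on_has_derivative[OF Suc.prems(2)]]])
       (use Suc in auto)
qed

lemma C_on_mult:
  fixes f g :: "'a::euclidean_space \<Rightarrow> real"
  assumes "open S" "C_on k f S" "C_on k g S"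
  shows "C_on k (\<lambda>x. f x * g x) S"
  using assms(2,3)
proof (induction k arbitrary: f g)
  case 0
  then show ?case by (simp add: continuous_on_mult)
next
  case (Suc k)
  show ?case
  proof (rule C_on_SucI[OF assms(1)
        has_derivative_mult[OF C_on_has_derivative[OF Suc.prems(1)] C_on_has_derivative[OF Suc.prems(2)]]])
    fix b :: 'a assume "b \<in> Basis"
    then show "C_on k (\<lambda>x. f x * frechet_derivative g (at x) b + frechet_derivative f (at x) b * g x) S"
      using Suc.prems C_on_SucD[OF Suc.prems(1)] C_on_SucD[OF Suc.prems(2)]
      by (intro C_on_add[OF assms(1)] Suc.IH) auto
  qed
qed

lemma C_on_minus:
  fixes f :: "'a::euclidean_space \<Rightarrow> real"
  assumes "open S" "C_on k f S" shows "C_on k (\<lambda>x. - f x) S"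
  using C_on_mult[OF assms(1) C_on_const[of k "- 1"] assms(2)] by simp

lemma C_on_diff:
  fixes f :: "'a::euclidean_space \<Rightarrow> real"
  assumes "open S" "C_on k f S" "C_on k g S" shows "C_on k (\<lambda>x. f x - g x) S"
  using C_on_add[OF assms(1,2) C_on_minus[OF assms(1,3)]] by simp

lemma C_on_power:
  fixes f :: "'a::euclidean_space \<Rightarrow> real"
  assumes "open S" "C_on k f S" shows "C_on k (\<lambda>x. f x ^ n) S"
  by (induction n) (simp_all add: C_on_const C_on_mult assms)

lemma C_on_sum:
  assumes "open S" "\<And>i. i \<in> I \<Longrightarrow> C_on k (f i) S"
  shows "C_on k (\<lambda>x. \<Sum>i\<in>I. f i x) S"
  using assms(2)
  by (induction I rule: infinite_finite_induct) (simp_all add: C_on_const C_on_add[OF assms(1)])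

lemma C_on_prod:
  fixes f :: "'i \<Rightarrow> 'a::euclidean_space \<Rightarrow> real"
  assumes "open S" "\<And>i. i \<in> I \<Longrightarrow> C_on k (f i) S"
  shows "C_on k (\<lambda>x. \<Prod>i\<in>I. f i x) S"
  using assms(2)
  by (induction I rule: infinite_finite_induct) (simp_all add: C_on_const C_on_mult[OF assms(1)])

lemma C_on_compose_nth:
  fixes S :: "(real ^ 'n) set"
  assumes "open S" and "\<And>x. x \<in> S \<Longrightarrow> (h has_real_derivative h' (x $ i)) (at (x $ i))"
    and "C_on k (\<lambda>x. h' (x $ i)) S"
  shows "C_on (Suc k) (\<lambda>x. h (x $ i)) S"
proof (rule C_on_SucI[OF assms(1)])
  fix x assume "x \<in> S"
  have "((\<lambda>x. x $ i) has_derivative (\<lambda>v. v $ i)) (at x)"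
    by (rule bounded_linear_imp_has_derivative[OF bounded_linear_vec_nth])
  from DERIV_compose_FDERIV[OF assms(2)[OF \<open>x \<in> S\<close>] this]
  show "((\<lambda>x. h (x $ i)) has_derivative (\<lambda>v. v $ i * h' (x $ i))) (at x)" .
next
  fix b :: "real ^ 'n"
  show "C_on k (\<lambda>x. b $ i * h' (x $ i)) S"
    by (intro C_on_mult[OF assms(1)] C_on_const assms(3))
qed

text \<open>This settles smoothness of the transition maps and of the action: in angle coordinates
  they are locally affine, with the same linear part everywhere.\<close>

lemma smooth_on_const_derivative:
  assumes "open S" and "\<And>x. x \<in> S \<Longrightarrow> (f has_derivative L) (at x)"
  shows "smooth_on f S"
  unfolding smooth_on_def
proof
  fix k show "C_on k f S"
  proof (cases k)
    case 0
    then show ?thesis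
      using assms(2) by (auto intro!: continuous_at_imp_continuous_on has_derivative_continuous)
  next
    case (Suc l)
    then show ?thesis
      using C_on_SucI[OF assms(1), of f "\<lambda>_. L" l] assms(2) C_on_const by blast
  qed
qed

lemma C_on_nth:
  fixes S :: "(real ^ 'n) set"
  assumes "open S"
  shows "C_on k (\<lambda>x. x $ i) S"
  using smooth_on_const_derivative[OF assms bounded_linear_imp_has_derivative[OF bounded_linear_vec_nth]]
  by (simp add: smooth_on_def)

section \<open>The torus and its product with an open set\<close>

lemma torus_exp_nth [simp]: "torus_exp t $ i = cis (t $ i)"
  by (simp add: torus_exp_def)

lemma torus_exp_add: "torus_exp (s + t) = torus_exp s * torus_exp t"
  by (simp add: vec_eq_iff cis_mult)

lemma torus_exp_in_torus [simp]: "torus_exp t \<in> torus"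
  by (simp add: torus_def)

lemma torus_mult: "s \<in> torus \<Longrightarrow> t \<in> torus \<Longrightarrow> s * t \<in> torus"
  by (simp add: torus_def norm_mult)

lemma torus_exp_surj:
  assumes "z \<in> torus" obtains t where "z = torus_exp t"
proof
  have "cis (Arg (z $ i)) = z $ i" for i
  proof -
    have "cmod (z $ i) = 1" using assms by (simp add: torus_def)
    then show ?thesis by (subst cis_Arg) (auto simp: sgn_div_norm)
  qed
  then show "z = torus_exp (\<chi> i. Arg (z $ i))"
    by (simp add: vec_eq_iff)
qed

lemma center_in_angle_cube [simp]: "a \<in> angle_cube a"
  by (simp add: angle_cube_def)

lemma open_angle_cube: "open (angle_cube (a :: real ^ 'n))"
proof -
  have "angle_cube a = (\<Inter>i. {t. \<bar>t $ i - a $ i\<bar> < pi})"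
    by (auto simp: angle_cube_def)
  then show ?thesis
    by (auto intro!: open_INT open_Collect_less continuous_intros)
qed

text \<open>An explicit inverse of the exponential: once the centre of the cube is rotated to angle
  0, the remaining angle lies in the range of \<open>Arg\<close>. Injectivity and continuity of the
  logarithm both come from this formula.\<close>

lemma angle_cube_nth_eq_Arg:
  assumes "t \<in> angle_cube a"
  shows "t $ i = a $ i + Arg (torus_exp t $ i * cis (- a $ i))"
proof -
  have "torus_exp t $ i * cis (- a $ i) = cis (t $ i - a $ i)"
    by (simp add: cis_mult)
  moreover have "t $ i - a $ i \<in> {-pi<..pi}"
    using assms by (auto simp: angle_cube_def abs_less_iff algebra_simps dest: spec[of _ i])
  ultimately show ?thesis by (simp add: Arg_cis)
qed

lemma inj_on_torus_exp: "inj_on torus_exp (angle_cube a)"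
  by (rule inj_onI) (metis angle_cube_nth_eq_Arg vec_eq_iff)

definition torus_log :: "real ^ 'n \<Rightarrow> complex ^ 'n \<Rightarrow> real ^ 'n" where
  "torus_log a = inv_into (angle_cube a) torus_exp"

lemma torus_log_exp [simp]: "t \<in> angle_cube a \<Longrightarrow> torus_log a (torus_exp t) = t"
  unfolding torus_log_def by (rule inv_into_f_f[OF inj_on_torus_exp])

text \<open>A chart omits the points with some component opposite to the centre, that is, on the
  branch cut after rotation. The description shows that the domain is relatively open and that
  \<open>Arg\<close> is continuous along it.\<close>

lemma image_angle_cube:
  "torus_exp ` angle_cube a = torus \<inter> {z. \<forall>i. z $ i * cis (- a $ i) \<notin> \<real>\<^sub>\<le>\<^sub>0}"
proof (intro equalityI subsetI)
  fix z assume "z \<in> torus_exp ` angle_cube a"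
  then obtain t where t: "t \<in> angle_cube a" "z = torus_exp t" by blast
  have unit: "Re w < 0 \<and> Im w = 0" if "w \<in> \<real>\<^sub>\<le>\<^sub>0" "cmod w = 1" for w
  proof -
    have w: "Re w \<le> 0" "Im w = 0" using that(1) unfolding complex_nonpos_Reals_iff by simp_all
    then have "\<bar>Re w\<bar> = 1" using cmod_eq_Re[of w] that(2) by simp
    then show ?thesis using w by linarith
  qed
  have "z $ i * cis (- a $ i) \<notin> \<real>\<^sub>\<le>\<^sub>0" for i
  proof
    assume "z $ i * cis (- a $ i) \<in> \<real>\<^sub>\<le>\<^sub>0"
    moreover have "cmod (z $ i * cis (- a $ i)) = 1"
      by (simp add: t(2) norm_mult)
    ultimately have "Re (z $ i * cis (- a $ i)) < 0 \<and> Im (z $ i * cis (- a $ i)) = 0"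
      by (rule unit)
    then have "Arg (z $ i * cis (- a $ i)) = pi"
      by (rule Arg_eq_pi[THEN iffD2])
    then have "\<bar>t $ i - a $ i\<bar> = pi"
      using angle_cube_nth_eq_Arg[OF t(1), of i] pi_gt_zero unfolding t(2) by linarith
    moreover have "\<bar>t $ i - a $ i\<bar> < pi" using t(1) by (simp add: angle_cube_def)
    ultimately show False by simp
  qed
  moreover have "z \<in> torus" by (simp add: t(2))
  ultimately show "z \<in> torus \<inter> {z. \<forall>i. z $ i * cis (- a $ i) \<notin> \<real>\<^sub>\<le>\<^sub>0}"
    by blast
next
  fix z assume z: "z \<in> torus \<inter> {z. \<forall>i. z $ i * cis (- a $ i) \<notin> \<real>\<^sub>\<le>\<^sub>0}"
  define t where "t = (\<chi> i. a $ i + Arg (z $ i * cis (- a $ i)))"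
  have "\<bar>Arg (z $ i * cis (- a $ i))\<bar> < pi" for i
  proof -
    have "z $ i * cis (- a $ i) \<notin> \<real>\<^sub>\<le>\<^sub>0" using z by blast
    then have "Arg (z $ i * cis (- a $ i)) \<noteq> pi"
      unfolding Arg_eq_pi complex_nonpos_Reals_iff by simp
    then show ?thesis
      using Arg_bounded[of "z $ i * cis (- a $ i)"] unfolding abs_less_iff by linarith
  qed
  then have "t \<in> angle_cube a"
    by (simp add: t_def angle_cube_def)
  moreover have "cis (t $ i) = z $ i" for i
  proof -
    have norm: "cmod (z $ i * cis (- a $ i)) = 1" using z by (simp add: torus_def norm_mult)
    then have "cis (Arg (z $ i * cis (- a $ i))) = z $ i * cis (- a $ i)"
      by (subst cis_Arg) (force, simp only: sgn_div_norm norm inverse_1 scaleR_one)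
    moreover have "cis (t $ i) = cis (a $ i) * cis (Arg (z $ i * cis (- a $ i)))"
      by (simp only: t_def vec_lambda_beta cis_mult)
    ultimately have "cis (t $ i) = z $ i * (cis (a $ i) * cis (- a $ i))"
      by (simp only: mult_ac)
    then show ?thesis by (simp add: cis_mult)
  qed
  then have "torus_exp t = z" by (simp add: vec_eq_iff)
  ultimately show "z \<in> torus_exp ` angle_cube a" by blast
qed

lemma open_angle_condition:
  "open {z :: complex ^ 'n. \<forall>i. z $ i * cis (- a $ i) \<notin> \<real>\<^sub>\<le>\<^sub>0}"
proof -
  have "{z :: complex ^ 'n. \<forall>i. z $ i * cis (- a $ i) \<notin> \<real>\<^sub>\<le>\<^sub>0}
      = (\<Inter>i. (\<lambda>z. z $ i * cis (- a $ i)) -` (- \<real>\<^sub>\<le>\<^sub>0))"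
    by auto
  moreover have "open ((\<lambda>z :: complex ^ 'n. z $ i * cis (- a $ i)) -` (- \<real>\<^sub>\<le>\<^sub>0))" for i
    by (intro open_vimage continuous_intros) (simp add: open_Compl)
  ultimately show ?thesis by auto
qed

lemma continuous_on_torus_log: "continuous_on (torus_exp ` angle_cube a) (torus_log a)"
proof -
  have "continuous_on (torus_exp ` angle_cube a) (\<lambda>z. \<chi> i. a $ i + Arg (z $ i * cis (- a $ i)))"
  proof (intro continuous_on_vec_lambda continuous_on_add continuous_on_const continuous_at_imp_continuous_on ballI)
    fix z i assume "z \<in> torus_exp ` angle_cube a"
    then have "z $ i * cis (- a $ i) \<notin> \<real>\<^sub>\<le>\<^sub>0" by (simp add: image_angle_cube)
    moreover have "isCont (\<lambda>z. z $ i * cis (- a $ i)) z" by (intro continuous_intros)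
    ultimately show "isCont (\<lambda>z. Arg (z $ i * cis (- a $ i))) z"
      using isCont_o2[OF _ continuous_at_Arg] by blast
  qed
  moreover have "torus_log a z = (\<chi> i. a $ i + Arg (z $ i * cis (- a $ i)))"
    if "z \<in> torus_exp ` angle_cube a" for z
    using that by (auto simp: vec_eq_iff angle_cube_nth_eq_Arg simp del: torus_exp_nth)
  ultimately show ?thesis
    by (simp cong: continuous_on_cong)
qed

lemma continuous_on_torus_exp: "continuous_on S torus_exp"
  unfolding torus_exp_def by (intro continuous_on_vec_lambda continuous_intros)

section \<open>Coordinates on the product and the covering map\<close>

definition angles :: "real ^ 7 \<Rightarrow> real ^ 4" where
  "angles x = vector [x $ 1, x $ 2, x $ 3, x $ 4]"

definition base :: "real ^ 7 \<Rightarrow> real ^ 3" where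
  "base x = vector [x $ 5, x $ 6, x $ 7]"

definition join :: "real ^ 4 \<Rightarrow> real ^ 3 \<Rightarrow> real ^ 7" where
  "join t y = vector [t $ 1, t $ 2, t $ 3, t $ 4, y $ 1, y $ 2, y $ 3]"

lemma exhaust_7:
  fixes i :: 7
  shows "i = 1 \<or> i = 2 \<or> i = 3 \<or> i = 4 \<or> i = 5 \<or> i = 6 \<or> i = 7"
proof (induct i)
  case (of_int z)
  then have "0 \<le> z" and "z < 7" by simp_all
  then have "z = 0 \<or> z = 1 \<or> z = 2 \<or> z = 3 \<or> z = 4 \<or> z = 5 \<or> z = 6" by arith
  then show ?case by auto
qed

lemma forall_7: "(\<forall>i::7. P i) \<longleftrightarrow> P 1 \<and> P 2 \<and> P 3 \<and> P 4 \<and> P 5 \<and> P 6 \<and> P 7"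
  by (metis exhaust_7)

lemma vector_nth_4:
  "(vector [a, b, c, d] :: 'a::zero ^ 4) $ 1 = a" "(vector [a, b, c, d] :: 'a ^ 4) $ 2 = b"
  "(vector [a, b, c, d] :: 'a ^ 4) $ 3 = c" "(vector [a, b, c, d] :: 'a ^ 4) $ 4 = d"
  by (simp_all add: vector_def)

lemma vector_nth_7:
  "(vector [a, b, c, d, e, f, g] :: 'a::zero ^ 7) $ 1 = a"
  "(vector [a, b, c, d, e, f, g] :: 'a ^ 7) $ 2 = b"
  "(vector [a, b, c, d, e, f, g] :: 'a ^ 7) $ 3 = c"
  "(vector [a, b, c, d, e, f, g] :: 'a ^ 7) $ 4 = d"
  "(vector [a, b, c, d, e, f, g] :: 'a ^ 7) $ 5 = e"
  "(vector [a, b, c, d, e, f, g] :: 'a ^ 7) $ 6 = f"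
  "(vector [a, b, c, d, e, f, g] :: 'a ^ 7) $ 7 = g"
  by (simp_all add: vector_def)

lemma angles_base_nth [simp]:
  "angles x $ 1 = x $ 1" "angles x $ 2 = x $ 2" "angles x $ 3 = x $ 3" "angles x $ 4 = x $ 4"
  "base x $ 1 = x $ 5" "base x $ 2 = x $ 6" "base x $ 3 = x $ 7"
  by (simp_all add: angles_def base_def vector_nth_4)

lemma join_nth [simp]:
  "join t y $ 1 = t $ 1" "join t y $ 2 = t $ 2" "join t y $ 3 = t $ 3" "join t y $ 4 = t $ 4"
  "join t y $ 5 = y $ 1" "join t y $ 6 = y $ 2" "join t y $ 7 = y $ 3"
  by (simp_all add: join_def vector_nth_7)

lemma angles_join [simp]: "angles (join t y) = t"
  and base_join [simp]: "base (join t y) = y"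
  and join_angles_base [simp]: "join (angles x) (base x) = x"
  by (simp_all add: vec_eq_iff forall_3 forall_4 forall_7)

lemma linear_angles: "linear angles" and linear_base: "linear base"
  and linear_join: "linear (\<lambda>p. join (fst p) (snd p))"
  by (rule linearI; simp add: vec_eq_iff forall_3 forall_4 forall_7)+

lemmas continuous_on_angles = linear_continuous_on[OF linear_conv_bounded_linear[THEN iffD1, OF linear_angles]]
lemmas continuous_on_base = linear_continuous_on[OF linear_conv_bounded_linear[THEN iffD1, OF linear_base]]
lemmas continuous_on_join = linear_continuous_on[OF linear_conv_bounded_linear[THEN iffD1, OF linear_join]]

text \<open>All charts are local inverses of this one covering map, and the torus action lifts to
  translation of the angles.\<close>

definition cover :: "real ^ 7 \<Rightarrow> point" where
  "cover x = (torus_exp (angles x), base x)"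

lemma cover_add_join: "cover (join s 0 + x) = (torus_exp s * torus_exp (angles x), base x)"
  by (simp add: cover_def linear_add[OF linear_angles] linear_add[OF linear_base] torus_exp_add)

lemma continuous_on_cover: "continuous_on S cover"
  unfolding cover_def
  by (intro continuous_on_Pair continuous_on_compose2[OF continuous_on_torus_exp continuous_on_angles]
      continuous_on_base) (rule subset_UNIV)

definition torus_action :: "complex ^ 4 \<Rightarrow> point \<Rightarrow> point" where
  "torus_action t p = (t * fst p, snd p)"

lemma second_countable_euclidean:
  "second_countable (euclidean :: 'a::second_countable_topology topology)"
proof -
  obtain B :: "'a set set" where B: "countable B" "topological_basis B"
    using ex_countable_basis by blast
  have "\<exists>V\<in>B. x \<in> V \<and> V \<subseteq> W" if "open W" "x \<in> W" for W x
    by (rule topological_basisE[OF B(2) that]) blast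
  then show ?thesis
    unfolding second_countable_def
  proof (intro exI[of _ B] conjI ballI allI impI)
    fix V assume "V \<in> B"
    then show "openin euclidean V" using topological_basis_open[OF B(2)] by simp
  qed (use B(1) in auto)
qed

locale torus_times_open =
  fixes U :: "(real ^ 3) set"
  assumes open_U: "open U"
begin

definition space_top :: "point topology" where
  "space_top = top_of_set (torus \<times> U)"

definition chart :: "real ^ 4 \<Rightarrow> (point, real ^ 7) chart" where
  "chart a = (torus_exp ` angle_cube a \<times> U, \<lambda>p. join (torus_log a (fst p)) (snd p))"

definition atlas :: "(point, real ^ 7) chart set" where
  "atlas = range chart"

definition chart_image :: "real ^ 4 \<Rightarrow> (real ^ 7) set" where
  "chart_image a = {x. angles x \<in> angle_cube a \<and> base x \<in> U}"

lemma topspace_space_top [simp]: "topspace space_top = torus \<times> U"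
  by (simp add: space_top_def)

lemma coord_cover [simp]: "x \<in> chart_image a \<Longrightarrow> coord (chart a) (cover x) = x"
  by (simp add: chart_def cover_def chart_image_def)

lemma cover_in_dom [simp]: "x \<in> chart_image a \<Longrightarrow> cover x \<in> dom_of (chart a)"
  by (auto simp: chart_def cover_def chart_image_def)

lemma dom_chart_eq: "dom_of (chart a) = cover ` chart_image a"
proof
  show "dom_of (chart a) \<subseteq> cover ` chart_image a"
  proof
    fix p assume "p \<in> dom_of (chart a)"
    then obtain t y where "p = (torus_exp t, y)" "t \<in> angle_cube a" "y \<in> U"
      by (auto simp: chart_def)
    then have "p = cover (join t y)" "join t y \<in> chart_image a"
      by (simp_all add: cover_def chart_image_def)
    then show "p \<in> cover ` chart_image a" by blast
  qed
qed auto

lemma dom_chartE: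
  assumes "p \<in> dom_of (chart a)"
  obtains x where "x \<in> chart_image a" "p = cover x" "coord (chart a) p = x"
  using assms unfolding dom_chart_eq by (metis coord_cover imageE)

lemma image_chart [simp]: "coord (chart a) ` dom_of (chart a) = chart_image a"
  unfolding dom_chart_eq image_image by simp

lemma coord_inv_chart: "x \<in> chart_image a \<Longrightarrow> coord_inv (chart a) x = cover x"
  unfolding coord_inv_def
proof (rule inv_into_f_eq)
  show "inj_on (coord (chart a)) (dom_of (chart a))"
    by (rule inj_onI) (metis dom_chartE)
qed auto

lemma open_chart_image: "open (chart_image a)"
proof -
  have "chart_image a = angles -` angle_cube a \<inter> base -` U"
    by (auto simp: chart_image_def)
  then show ?thesis
    using open_vimage[OF open_angle_cube continuous_on_angles] open_vimage[OF open_U continuous_on_base]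
    by (simp add: open_Int)
qed

lemma openin_dom_chart: "openin space_top (dom_of (chart a))"
proof -
  have "dom_of (chart a)
      = (torus \<times> U) \<inter> ({z. \<forall>i. z $ i * cis (- a $ i) \<notin> \<real>\<^sub>\<le>\<^sub>0} \<times> UNIV)"
    by (auto simp: chart_def image_angle_cube)
  then show ?thesis
    unfolding space_top_def openin_open using open_Times[OF open_angle_condition open_UNIV] by blast
qed

lemma dom_chart_subset: "dom_of (chart a) \<subseteq> torus \<times> U"
  by (auto simp: chart_def)

lemma open_cover_vimage: "open (cover -` dom_of (chart a))"
proof -
  have "cover -` dom_of (chart a)
      = angles -` (torus_exp -` {z. \<forall>i. z $ i * cis (- a $ i) \<notin> \<real>\<^sub>\<le>\<^sub>0}) \<inter> base -` U"
    by (auto simp: chart_def cover_def image_angle_cube)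
  then show ?thesis
    using open_vimage[OF open_vimage[OF open_angle_condition[of a] continuous_on_torus_exp] continuous_on_angles]
      open_vimage[OF open_U continuous_on_base]
    by (simp add: open_Int)
qed

text \<open>The angles of \<open>x\<close> and those read off by the chart differ by periods. This
  shift stays the same as long as the shifted angles remain in the cube.\<close>

lemma coord_cover_locally:
  assumes "cover x \<in> dom_of (chart a)"
  obtains W c where "open W" "x \<in> W" "\<And>x'. x' \<in> W \<Longrightarrow> coord (chart a) (cover x') = x' + c"
proof -
  obtain t where t: "t \<in> angle_cube a" "torus_exp t = torus_exp (angles x)"
    using assms by (auto simp: chart_def cover_def)
  define W where "W = {x'. t + (angles x' - angles x) \<in> angle_cube a}"
  have "W = (\<lambda>x'. t + (angles x' - angles x)) -` angle_cube a"
    by (auto simp: W_def)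
  then have "open W"
    by (auto intro!: open_vimage open_angle_cube continuous_on_add continuous_on_diff continuous_on_const
        continuous_on_angles)
  moreover have "x \<in> W" using t by (simp add: W_def)
  moreover have "coord (chart a) (cover x') = x' + join (t - angles x) 0" if "x' \<in> W" for x'
  proof -
    have "torus_exp (t + (angles x' - angles x)) = torus_exp (angles x + (angles x' - angles x))"
      by (simp only: torus_exp_add t)
    then have "torus_log a (torus_exp (angles x')) = t + (angles x' - angles x)"
      using that torus_log_exp[of "t + (angles x' - angles x)" a] by (simp add: W_def)
    then show ?thesis
      by (simp add: chart_def cover_def vec_eq_iff forall_7)
  qed
  ultimately show ?thesis using that by blast
qed

lemma coord_cover_has_derivative:
  assumes "cover x \<in> dom_of (chart a)"
  shows "((\<lambda>x. coord (chart a) (cover x)) has_derivative (\<lambda>v. v)) (at x)"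
proof -
  obtain W c where W: "open W" "x \<in> W" "\<And>x'. x' \<in> W \<Longrightarrow> coord (chart a) (cover x') = x' + c"
    using coord_cover_locally[OF assms] by blast
  have "((\<lambda>x. x + c) has_derivative (\<lambda>v. v)) (at x)"
    by (auto intro!: derivative_eq_intros)
  then show ?thesis
    by (rule has_derivative_transform_within_open[OF _ W(1,2)]) (simp add: W(3))
qed

lemma translate_cover_has_derivative:
  assumes "cover (v + x) \<in> dom_of (chart b)"
  shows "((\<lambda>x. coord (chart b) (cover (v + x))) has_derivative (\<lambda>v. v)) (at x)"
proof -
  have "((\<lambda>x. v + x) has_derivative (\<lambda>v. v)) (at x)"
    by (auto intro!: derivative_eq_intros)
  from has_derivative_compose[OF this coord_cover_has_derivative[OF assms]] show ?thesis .
qed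

lemma base_coord_chart: "base (coord (chart a) p) = snd p"
  by (simp add: chart_def)

lemma smooth_manifold_atlas: "smooth_manifold space_top atlas"
  unfolding smooth_manifold_def
proof (intro conjI ballI)
  show "Hausdorff_space space_top"
    unfolding space_top_def by (intro Hausdorff_space_subtopology) simp
  show "second_countable space_top"
    unfolding space_top_def by (intro second_countable_subtopology second_countable_euclidean)
  show "(\<Union>c\<in>atlas. dom_of c) = topspace space_top"
  proof (intro equalityI subsetI)
    fix p assume "p \<in> topspace space_top"
    then have "fst p \<in> torus" "snd p \<in> U" by auto
    moreover from this obtain t where "fst p = torus_exp t" using torus_exp_surj by blast
    ultimately have "fst p = torus_exp t" "snd p \<in> U" by simp_all
    then have "p \<in> dom_of (chart t)" by (auto simp: chart_def mem_Times_iff)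
    then show "p \<in> (\<Union>c\<in>atlas. dom_of c)" by (auto simp: atlas_def)
  qed (use dom_chart_subset in \<open>auto simp: atlas_def\<close>)
next
  fix c assume "c \<in> atlas"
  then obtain a where c: "c = chart a" by (auto simp: atlas_def)
  show "openin space_top (dom_of c)" by (simp add: c openin_dom_chart)
  show "open (coord c ` dom_of c)" by (simp add: c open_chart_image)
  show "homeomorphic_map (subtopology space_top (dom_of c)) (top_of_set (coord c ` dom_of c)) (coord c)"
    unfolding homeomorphic_map_maps homeomorphic_maps_def
  proof (intro exI[of _ cover] conjI ballI)
    have sub: "subtopology space_top (dom_of c) = top_of_set (dom_of c)"
      using dom_chart_subset[of a] unfolding space_top_def c
      by (simp add: subtopology_subtopology Int_absorb1)
    have "continuous_on (dom_of (chart a)) (\<lambda>p. (torus_log a (fst p), snd p))"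
      by (intro continuous_on_Pair continuous_on_compose2[OF continuous_on_torus_log continuous_on_fst]
          continuous_on_snd continuous_on_id) (auto simp: chart_def)
    from continuous_on_compose2[OF continuous_on_join this subset_UNIV]
    have "continuous_on (dom_of (chart a)) (coord (chart a))"
      by (simp add: chart_def)
    then show "continuous_map (subtopology space_top (dom_of c)) (top_of_set (coord c ` dom_of c)) (coord c)"
      unfolding sub by (auto simp: c simp flip: image_chart)
    show "continuous_map (top_of_set (coord c ` dom_of c)) (subtopology space_top (dom_of c)) cover"
      unfolding sub using continuous_on_cover by (auto simp: c)
  next
    fix p assume "p \<in> topspace (subtopology space_top (dom_of c))"
    then have "p \<in> dom_of (chart a)" by (simp add: c)
    then show "cover (coord c p) = p" unfolding c by (metis dom_chartE)
  next
    fix x assume "x \<in> topspace (top_of_set (coord c ` dom_of c))"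
    then show "coord c (cover x) = x" by (simp add: c)
  qed
next
  fix c d assume "c \<in> atlas" "d \<in> atlas"
  then obtain a b where c: "c = chart a" and d: "d = chart b" by (auto simp: atlas_def)
  have S: "coord c ` (dom_of c \<inter> dom_of d) = chart_image a \<inter> cover -` dom_of (chart b)"
    unfolding c d
  proof (intro equalityI subsetI)
    fix x assume "x \<in> coord (chart a) ` (dom_of (chart a) \<inter> dom_of (chart b))"
    then obtain p where p: "x = coord (chart a) p" "p \<in> dom_of (chart a)" "p \<in> dom_of (chart b)"
      by auto
    then show "x \<in> chart_image a \<inter> cover -` dom_of (chart b)"
      using p(2) by (auto elim!: dom_chartE[of p a])
  next
    fix x assume "x \<in> chart_image a \<inter> cover -` dom_of (chart b)"
    then show "x \<in> coord (chart a) ` (dom_of (chart a) \<inter> dom_of (chart b))"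
      by (intro image_eqI[of _ _ "cover x"]) auto
  qed
  have opn: "open (chart_image a \<inter> cover -` dom_of (chart b))"
    by (intro open_Int open_chart_image open_cover_vimage)
  show "smooth_on (coord d \<circ> coord_inv c) (coord c ` (dom_of c \<inter> dom_of d))"
    unfolding S
  proof (rule smooth_on_const_derivative[OF opn])
    fix x assume x: "x \<in> chart_image a \<inter> cover -` dom_of (chart b)"
    then have "((\<lambda>x. coord (chart b) (cover x)) has_derivative (\<lambda>v. v)) (at x)"
      by (intro coord_cover_has_derivative) simp
    then show "(coord d \<circ> coord_inv c has_derivative (\<lambda>v. v)) (at x)"
      by (rule has_derivative_transform_within_open[OF _ opn x]) (simp add: c d coord_inv_chart)
  qed
qed

lemma connected_space_top:
  assumes "connected U" shows "connected_space space_top"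
proof -
  have "connected (torus_exp ` (UNIV :: (real ^ 4) set))"
    by (intro connected_continuous_image continuous_on_torus_exp convex_connected convex_UNIV)
  moreover have "torus_exp ` UNIV = (torus :: (complex ^ 4) set)"
  proof (intro equalityI subsetI)
    fix z :: "complex ^ 4" assume "z \<in> torus"
    then show "z \<in> range torus_exp" by (rule torus_exp_surj) blast
  qed auto
  ultimately have "connected ((torus :: (complex ^ 4) set) \<times> U)"
    using assms by (simp add: connected_Times)
  then show ?thesis
    by (simp add: space_top_def connected_space_subtopology)
qed

text \<open>On the covering the action adds the angles of the group element, so its coordinate
  expression has the constant derivative that sends (s, x) to \<open>join s 0 + x\<close>.\<close>

lemma smooth_torus_action_atlas: "smooth_torus_action space_top atlas torus_action"
  unfolding smooth_torus_action_def smooth_map_def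
proof (intro conjI ballI)
  fix p show "torus_action 1 p = p" by (simp add: torus_action_def)
next
  fix s t p show "torus_action (s * t) p = torus_action s (torus_action t p)"
    by (simp add: torus_action_def mult.assoc)
next
  have "continuous_on (torus \<times> torus \<times> U) (\<lambda>q. (fst q * fst (snd q), snd (snd q)))"
    unfolding times_vec_def
    by (intro continuous_on_Pair continuous_on_vec_lambda continuous_intros)
  then show "continuous_map (prod_topology (top_of_set torus) space_top) space_top (\<lambda>(t, p). torus_action t p)"
    unfolding space_top_def
    by (auto simp: torus_action_def case_prod_beta torus_mult)
next
  fix c :: "((complex ^ 4) \<times> point, (real ^ 4) \<times> (real ^ 7)) chart" and d :: "(point, real ^ 7) chart"
  assume "c \<in> prod_atlas torus_atlas atlas" and "d \<in> atlas"
  then obtain a' a b where d: "d = chart b"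
    and c: "c = (torus_exp ` angle_cube a' \<times> dom_of (chart a), \<lambda>(p, q). (torus_log a' p, coord (chart a) q))"
    by (auto simp: prod_atlas_def torus_atlas_def atlas_def torus_log_def)
  have inv: "coord_inv c (s, x) = (torus_exp s, cover x)" if "s \<in> angle_cube a'" "x \<in> chart_image a" for s x
    unfolding coord_inv_def
  proof (rule inv_into_f_eq)
    show "inj_on (coord c) (dom_of c)"
      by (rule inj_onI) (auto simp: c elim!: dom_chartE)
  qed (use that in \<open>auto simp: c\<close>)
  define S where "S = {(s, x). s \<in> angle_cube a' \<and> x \<in> chart_image a \<and> cover (join s 0 + x) \<in> dom_of (chart b)}"
  have act: "torus_action (torus_exp s) (cover x) = cover (join s 0 + x)" for s x
    by (simp add: cover_add_join torus_action_def) (simp add: cover_def)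
  have S_eq: "coord c ` {p \<in> dom_of c. (case p of (t, p) \<Rightarrow> torus_action t p) \<in> dom_of d} = S"
  proof (intro equalityI subsetI)
    fix q assume "q \<in> coord c ` {p \<in> dom_of c. (case p of (t, p) \<Rightarrow> torus_action t p) \<in> dom_of d}"
    then obtain s p where q: "q = (s, coord (chart a) p)" "s \<in> angle_cube a'" "p \<in> dom_of (chart a)"
        "torus_action (torus_exp s) p \<in> dom_of (chart b)"
      by (auto simp: c d)
    moreover obtain x where "x \<in> chart_image a" "p = cover x" "coord (chart a) p = x"
      using q(3) by (rule dom_chartE)
    ultimately show "q \<in> S"
      by (simp add: S_def act)
  next
    fix q assume "q \<in> S"
    then obtain s x where q: "q = (s, x)" "s \<in> angle_cube a'" "x \<in> chart_image a"
        "cover (join s 0 + x) \<in> dom_of (chart b)"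
      by (auto simp: S_def)
    then show "q \<in> coord c ` {p \<in> dom_of c. (case p of (t, p) \<Rightarrow> torus_action t p) \<in> dom_of d}"
      by (intro image_eqI[of _ _ "(torus_exp s, cover x)"]) (auto simp: c d act)
  qed
  have lin: "linear (\<lambda>q. join (fst q) 0 + (snd q :: real ^ 7))"
    by (rule linearI; simp add: vec_eq_iff forall_7 algebra_simps)
  have "S = (angle_cube a' \<times> chart_image a) \<inter> (\<lambda>q. join (fst q) 0 + snd q) -` (cover -` dom_of (chart b))"
    by (auto simp: S_def)
  moreover have "open ((\<lambda>q. join (fst q) 0 + (snd q :: real ^ 7)) -` (cover -` dom_of (chart b)))"
    using lin by (intro open_vimage open_cover_vimage linear_continuous_on) (simp add: linear_conv_bounded_linear)
  ultimately have opn: "open S"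
    by (auto intro!: open_Int open_Times open_angle_cube open_chart_image)
  show "smooth_on (coord d \<circ> (\<lambda>(t, p). torus_action t p) \<circ> coord_inv c)
      (coord c ` {p \<in> dom_of c. (case p of (t, p) \<Rightarrow> torus_action t p) \<in> dom_of d})"
    unfolding S_eq
  proof (rule smooth_on_const_derivative[OF opn])
    fix q assume q: "q \<in> S"
    have "((\<lambda>q. coord (chart b) (cover (join (fst q) 0 + snd q))) has_derivative
        (\<lambda>q. join (fst q) 0 + snd q)) (at q)"
      by (rule has_derivative_compose[OF linear_imp_has_derivative[OF lin] coord_cover_has_derivative])
         (use q in \<open>auto simp: S_def\<close>)
    then show "(coord d \<circ> (\<lambda>(t, p). torus_action t p) \<circ> coord_inv c has_derivative
        (\<lambda>q. join (fst q) 0 + snd q)) (at q)"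
      by (rule has_derivative_transform_within_open[OF _ opn q]) (auto simp: S_def d inv act)
  qed
qed

lemma effective_torus_action_space_top:
  assumes "U \<noteq> {}" shows "effective_torus_action space_top torus_action"
  unfolding effective_torus_action_def
proof (intro ballI impI)
  fix t :: "complex ^ 4" assume *: "\<forall>p\<in>topspace space_top. torus_action t p = p"
  obtain y where "y \<in> U" using assms by blast
  then have "(1, y) \<in> topspace space_top" by (simp add: torus_def)
  then have "torus_action t (1, y) = (1, y)" using * by blast
  then show "t = 1" by (simp add: torus_action_def)
qed

text \<open>Transition maps are local translations. A family of local representatives is therefore
  consistent as soon as they coincide at corresponding points.\<close>

lemma pullback_transition:
  assumes "c \<in> atlas" "d \<in> atlas" "p \<in> dom_of c \<inter> dom_of d"
  shows "pullback (frechet_derivative (coord d \<circ> coord_inv c) (at (coord c p))) \<alpha> = \<alpha>"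
proof -
  obtain a b where c: "c = chart a" and d: "d = chart b" using assms by (auto simp: atlas_def)
  obtain x where x: "x \<in> chart_image a" "p = cover x" "coord c p = x"
    using assms dom_chartE unfolding c by blast
  have "((\<lambda>x. coord (chart b) (cover x)) has_derivative (\<lambda>v. v)) (at x)"
    using assms(3) x by (intro coord_cover_has_derivative) (simp add: d)
  then have "(coord d \<circ> coord_inv c has_derivative (\<lambda>v. v)) (at x)"
    by (rule has_derivative_transform_within_open[OF _ open_chart_image x(1)]) (simp add: c d coord_inv_chart)
  then show ?thesis
    by (simp add: x(3) frechet_derivativeI pullback_def)
qed

text \<open>The hypothesis on \<open>\<omega>\<close> says that its coefficients depend on the slab
  coordinates alone. The action fixes these and has the identity as its derivative in
  coordinates.\<close>

lemma preserves_form_torus_action: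
  assumes "t \<in> torus"
    and \<omega>: "\<And>c d x y. c \<in> atlas \<Longrightarrow> d \<in> atlas \<Longrightarrow> base x = base y \<Longrightarrow> \<omega> c x = \<omega> d y"
  shows "preserves_form atlas \<omega> (torus_action t)"
  unfolding preserves_form_def
proof (intro ballI impI)
  fix c d p assume cd: "c \<in> atlas" "d \<in> atlas" and p: "p \<in> dom_of c" "torus_action t p \<in> dom_of d"
  obtain a b where c: "c = chart a" and d: "d = chart b" using cd by (auto simp: atlas_def)
  obtain x where x: "x \<in> chart_image a" "p = cover x" "coord c p = x"
    using p dom_chartE unfolding c by blast
  obtain s where s: "t = torus_exp s" using torus_exp_surj[OF assms(1)] .
  have act: "torus_action t (cover x) = cover (join s 0 + x)" for x
    by (simp add: cover_add_join torus_action_def s) (simp add: cover_def)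
  have "((\<lambda>x. coord (chart b) (cover (join s 0 + x))) has_derivative (\<lambda>v. v)) (at x)"
    using p x by (intro translate_cover_has_derivative) (simp add: d act)
  then have "(coord d \<circ> torus_action t \<circ> coord_inv c has_derivative (\<lambda>v. v)) (at x)"
    by (rule has_derivative_transform_within_open[OF _ open_chart_image x(1)])
       (simp add: c d coord_inv_chart act)
  moreover have "\<omega> c (coord c p) = \<omega> d (coord d (torus_action t p))"
    using cd by (intro \<omega>) (simp_all add: c d base_coord_chart torus_action_def)
  ultimately show "\<omega> c (coord c p) = pullback (frechet_derivative (coord d \<circ> torus_action t \<circ> coord_inv c)
      (at (coord c p))) (\<omega> d (coord d (torus_action t p)))"
    by (simp add: x(3) frechet_derivativeI pullback_def)
qed

end

section \<open>The coframe\<close>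

text \<open>In affine coordinates the multi-moment map is \<open>(1, x, y, z) / s\<close> up to constants, where \<open>s\<close> is a
  function of \<open>x\<close> with \<open>s'' = 5 / (2 * s ^ 6)\<close>. The first integral \<open>s'\<^sup>2 = 1 - 1 / s ^ 5\<close> is parametrised by
  \<open>s' = sin (10 * r)\<close> and \<open>s = 1 / rho r ^ 2\<close>, and then \<open>x = prim r\<close>.\<close>

definition rho :: "real \<Rightarrow> real" where
  "rho r = cos (10 * r) powr (1 / 5)"

definition kap :: "real \<Rightarrow> real" where
  "kap r = tan (10 * r)"

text \<open>The integrand is dx / dr. From s = rho^-2 one gets ds / dr = 4 k rho^-2, and ds / dx =
  sin (10 r) = k rho^5, so the quotient is 4 rho^-7.\<close>

definition prim :: "real \<Rightarrow> real" where
  "prim r = integral {- 1 / 10..r} (\<lambda>s. 4 * inverse (rho s) ^ 7)"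

lemma cos_10_pos:
  fixes r :: real
  assumes "\<bar>r\<bar> \<le> 1 / 10" shows "cos (10 * r) > 0"
  using assms pi_gt3 by (intro cos_gt_zero_pi) (simp_all add: abs_le_iff)

lemma rho_pos: "\<bar>r\<bar> \<le> 1 / 10 \<Longrightarrow> rho r > 0"
  using cos_10_pos[of r] by (simp add: rho_def)

lemma DERIV_rho:
  assumes "\<bar>r\<bar> \<le> 1 / 10"
  shows "(rho has_real_derivative - 2 * kap r * rho r) (at r)"
proof -
  have pos: "cos (10 * r) > 0" using assms by (rule cos_10_pos)
  have "((\<lambda>r. cos (10 * r)) has_real_derivative - 10 * sin (10 * r)) (at r)"
    by (auto intro!: derivative_eq_intros)
  then have "((\<lambda>r. cos (10 * r) powr (1 / 5)) has_real_derivative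
      1 / 5 * cos (10 * r) powr (1 / 5 - 1) * (- 10 * sin (10 * r))) (at r)"
    using DERIV_fun_powr[of "\<lambda>r. cos (10 * r)" "- 10 * sin (10 * r)" r "1 / 5"] pos by simp
  moreover have "1 / 5 * cos (10 * r) powr (1 / 5 - 1) * (- 10 * sin (10 * r)) = - 2 * kap r * rho r"
    using pos powr_mult_base[of "cos (10 * r)" "- (4 / 5)"] by (simp add: kap_def rho_def tan_def field_simps)
  ultimately show ?thesis by (simp add: rho_def[abs_def] mult.assoc)
qed

lemma DERIV_kap:
  assumes "\<bar>r\<bar> \<le> 1 / 10"
  shows "(kap has_real_derivative 10 * (1 + kap r ^ 2)) (at r)"
proof -
  have "cos (10 * r) \<noteq> 0" using cos_10_pos[OF assms] by simp
  then have "((\<lambda>r. tan (10 * r)) has_real_derivative inverse ((cos (10 * r))\<^sup>2) * 10) (at r)"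
    by (intro DERIV_chain2[OF DERIV_tan]) (auto intro!: derivative_eq_intros)
  moreover have "inverse ((cos (10 * r))\<^sup>2) = 1 + kap r ^ 2"
    using tan_sec[OF \<open>cos (10 * r) \<noteq> 0\<close>] by (simp add: kap_def power_inverse)
  ultimately show ?thesis by (simp add: kap_def[abs_def] mult.commute)
qed

lemma DERIV_inverse_rho:
  assumes "\<bar>r\<bar> \<le> 1 / 10"
  shows "((\<lambda>r. inverse (rho r)) has_real_derivative 2 * kap r * inverse (rho r)) (at r)"
  using DERIV_inverse'[OF DERIV_rho[OF assms]] rho_pos[OF assms]
  by (simp add: field_simps)

lemma DERIV_prim:
  assumes "\<bar>r\<bar> < 1 / 10"
  shows "(prim has_real_derivative 4 * inverse (rho r) ^ 7) (at r)"
proof -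
  have cont: "continuous_on {- 1 / 10..1 / 10} (\<lambda>r. inverse (rho r))"
    by (intro continuous_at_imp_continuous_on ballI DERIV_isCont[OF DERIV_inverse_rho]) auto
  have "continuous_on {- 1 / 10..1 / 10} (\<lambda>s. 4 * inverse (rho s) ^ 7)"
    by (intro continuous_on_mult continuous_on_power continuous_on_const cont)
  then have "((\<lambda>r. integral {- 1 / 10..r} (\<lambda>s. 4 * inverse (rho s) ^ 7)) has_real_derivative
      4 * inverse (rho r) ^ 7) (at r within {- 1 / 10..1 / 10})"
    by (rule integral_has_real_derivative) (use assms in \<open>auto simp: abs_less_iff\<close>)
  then have "(prim has_real_derivative 4 * inverse (rho r) ^ 7) (at r within {- 1 / 10..1 / 10})"
    by (simp only: prim_def[abs_def])
  moreover have "r \<in> interior {- 1 / 10..1 / 10}"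
    using assms by (simp add: abs_less_iff) linarith
  ultimately show ?thesis
    by (simp only: at_within_interior)
qed

definition base_domain :: "(real ^ 3) set" where
  "base_domain = {y. \<bar>y $ 1\<bar> < 1 / 10}"

lemma open_base_domain: "open base_domain"
  unfolding base_domain_def by (intro open_Collect_less continuous_intros)

lemma convex_base_domain: "convex base_domain"
proof -
  have "base_domain = (\<lambda>y. y $ 1) -` {- 1 / 10<..<1 / 10}"
    by (auto simp: base_domain_def abs_less_iff)
  also have "convex \<dots>"
    by (intro convex_linear_vimage bounded_linear.linear[OF bounded_linear_vec_nth]) simp
  finally show ?thesis .
qed

text \<open>The coordinates are four angles \<open>x $ 1, \<dots>, x $ 4\<close> and \<open>(r, y, z) = (x $ 5, x $ 6, x $ 7)\<close>.\<close>

definition xi1 :: "real ^ 7 \<Rightarrow> real ^ 7 \<Rightarrow> real" where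
  "xi1 x v = v $ 2 + 4 * x $ 6 * v $ 7 - prim (x $ 5) * v $ 1"

definition xi2 :: "real ^ 7 \<Rightarrow> real ^ 7 \<Rightarrow> real" where
  "xi2 x v = v $ 3 - 6 * x $ 7 * rho (x $ 5) ^ 3 * v $ 5 - 4 * x $ 6 * v $ 1"

definition xi3 :: "real ^ 7 \<Rightarrow> real ^ 7 \<Rightarrow> real" where
  "xi3 x v = v $ 4 + 6 * x $ 6 * rho (x $ 5) ^ 3 * v $ 5 - 4 * x $ 7 * v $ 1"

text \<open>The last branch also takes index 0 and the indices above 7, so that linearity and
  smoothness hold for every index.\<close>

definition frame_form :: "real ^ 7 \<Rightarrow> nat \<Rightarrow> real ^ 7 \<Rightarrow> real" where
  "frame_form x i v =
     (if i = 1 then v $ 5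
      else if i = 2 then rho (x $ 5) ^ 2 * v $ 6
      else if i = 3 then inverse (rho (x $ 5)) * xi3 x v
      else if i = 4 then rho (x $ 5) ^ 2 * v $ 7
      else if i = 5 then inverse (rho (x $ 5)) * xi2 x v
      else if i = 6 then - (rho (x $ 5) ^ 4) * xi1 x v
      else inverse (rho (x $ 5)) ^ 3 * v $ 1 + kap (x $ 5) * rho (x $ 5) ^ 4 * xi1 x v)"

text \<open>Up to scale, vectors 1, 4 and 7 are the directions of r, z and the first angle,
  corrected along the other angles so that \<open>xi1\<close>, \<open>xi2\<close> and
  \<open>xi3\<close> vanish on them. Vector 6 is \<open>k\<close> times vector 7 minus
  \<open>inverse s ^ 4\<close> times the direction of the second angle.\<close>

definition frame_vector :: "real ^ 7 \<Rightarrow> nat \<Rightarrow> real ^ 7" where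
  "frame_vector x i =
     (let s = rho (x $ 5); k = kap (x $ 5); X = prim (x $ 5); y = x $ 6; z = x $ 7 in
      if i = 1 then vector [0, 0, 6 * z * s ^ 3, - 6 * y * s ^ 3, 1, 0, 0]
      else if i = 2 then vector [0, 0, 0, 0, 0, inverse s ^ 2, 0]
      else if i = 3 then vector [0, 0, 0, s, 0, 0, 0]
      else if i = 4 then vector [0, - 4 * y * inverse s ^ 2, 0, 0, 0, 0, inverse s ^ 2]
      else if i = 5 then vector [0, 0, s, 0, 0, 0, 0]
      else if i = 6 then vector [k * s ^ 3, X * k * s ^ 3 - inverse s ^ 4, 4 * y * k * s ^ 3, 4 * z * k * s ^ 3, 0, 0, 0]
      else vector [s ^ 3, X * s ^ 3, 4 * y * s ^ 3, 4 * z * s ^ 3, 0, 0, 0])"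

lemmas frame_defs = frame_form_def xi1_def xi2_def xi3_def

lemma frame_form_simps:
  "frame_form x 1 v = v $ 5"
  "frame_form x 2 v = rho (x $ 5) ^ 2 * v $ 6"
  "frame_form x 3 v = inverse (rho (x $ 5)) * xi3 x v"
  "frame_form x 4 v = rho (x $ 5) ^ 2 * v $ 7"
  "frame_form x 5 v = inverse (rho (x $ 5)) * xi2 x v"
  "frame_form x 6 v = - (rho (x $ 5) ^ 4) * xi1 x v"
  "frame_form x 7 v = inverse (rho (x $ 5)) ^ 3 * v $ 1 + kap (x $ 5) * rho (x $ 5) ^ 4 * xi1 x v"
  by (simp_all add: frame_form_def)

lemma index_cases: "i \<in> {1..7::nat} \<Longrightarrow> i = 1 \<or> i = 2 \<or> i = 3 \<or> i = 4 \<or> i = 5 \<or> i = 6 \<or> i = 7"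
  by auto

lemma linear_frame_form: "linear (frame_form x i)"
  by (rule linearI) (simp_all add: frame_defs algebra_simps)

lemma frame_form_vector:
  assumes "\<bar>x $ 5\<bar> \<le> 1 / 10" and i: "i \<in> {1..7}" and j: "j \<in> {1..7}"
  shows "frame_form x i (frame_vector x j) = (if i = j then 1 else 0)"
proof -
  have "rho (x $ 5) \<noteq> 0" using rho_pos[OF assms(1)] by simp
  then show ?thesis
    using index_cases[OF i] index_cases[OF j]
    by (elim disjE) (simp_all add: frame_defs frame_vector_def Let_def vector_nth_7 field_simps)
qed

lemma dual_coframe_frame_form:
  assumes "\<bar>x $ 5\<bar> \<le> 1 / 10" shows "dual_coframe (frame_form x) (frame_vector x)"
  by (intro dual_coframe.intro linear_frame_form frame_form_vector assms)

text \<open>The derivatives of the four profiles are polynomials in \<open>rho\<close>,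
  \<open>kap\<close> and \<open>inverse rho\<close>. Hence the simultaneous induction: regularity of
  all at one order gives the next.\<close>

lemma C_on_profiles:
  assumes S: "open S" "\<And>x. x \<in> S \<Longrightarrow> \<bar>x $ 5\<bar> < 1 / 10"
  shows "C_on k (\<lambda>x :: real ^ 7. rho (x $ 5)) S \<and> C_on k (\<lambda>x. kap (x $ 5)) S \<and>
    C_on k (\<lambda>x. inverse (rho (x $ 5))) S \<and> C_on k (\<lambda>x. prim (x $ 5)) S"
proof (induction k)
  case 0
  have "isCont (\<lambda>x :: real ^ 7. h (x $ 5)) x" if "(h has_real_derivative D) (at (x $ 5))" for h D x
  proof -
    have "isCont (\<lambda>x :: real ^ 7. x $ 5) x" by (intro continuous_intros)
    then show ?thesis by (rule isCont_o2[where g = h]) (rule DERIV_isCont[OF that])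
  qed
  from this[OF DERIV_rho] this[OF DERIV_kap] this[OF DERIV_inverse_rho] this[OF DERIV_prim] S(2)
  show ?case
    by (auto intro!: continuous_at_imp_continuous_on simp: less_imp_le)
next
  case (Suc k)
  have bound: "\<bar>x $ 5\<bar> \<le> 1 / 10" if "x \<in> S" for x using S(2)[OF that] by simp
  show ?case
    using Suc
    by (intro conjI C_on_compose_nth[OF S(1) DERIV_rho[OF bound]] C_on_compose_nth[OF S(1) DERIV_kap[OF bound]]
        C_on_compose_nth[OF S(1) DERIV_inverse_rho[OF bound]] C_on_compose_nth[OF S(1) DERIV_prim[OF S(2)]]
        C_on_add[OF S(1)] C_on_mult[OF S(1)] C_on_power[OF S(1)] C_on_const) auto
qed

lemma C_on_frame_form:
  assumes S: "open S" "\<And>x. x \<in> S \<Longrightarrow> \<bar>x $ 5\<bar> < 1 / 10"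
  shows "C_on k (\<lambda>x. frame_form x i v) S"
proof -
  note C = C_on_profiles[OF S, of k]
  have xi: "C_on k (\<lambda>x. xi1 x v) S" "C_on k (\<lambda>x. xi2 x v) S" "C_on k (\<lambda>x. xi3 x v) S"
    unfolding xi1_def xi2_def xi3_def using C
    by (auto intro!: C_on_add[OF S(1)] C_on_diff[OF S(1)] C_on_mult[OF S(1)] C_on_power[OF S(1)] C_on_const
        C_on_nth[OF S(1)])
  then show ?thesis
    unfolding frame_form_def using C
    by (cases "i \<in> {1, 2, 3, 4, 5, 6}")
       (auto intro!: C_on_add[OF S(1)] C_on_minus[OF S(1)] C_on_mult[OF S(1)] C_on_power[OF S(1)] C_on_const)
qed

lemma C_on_comb_form:
  assumes "open S" "\<And>i v. C_on k (\<lambda>x. e x i v) S"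
  shows "C_on k (\<lambda>x. comb_form (e x) L v) S"
proof (induction L)
  case Nil
  then show ?case by (simp add: C_on_const)
next
  case (Cons a L)
  obtain c I where a: "a = (c, I)" by fastforce
  have "C_on k (\<lambda>x. wedge_list (map (e x) I) v) S"
    unfolding wedge_list_def length_map
    by (intro C_on_sum[OF assms(1)] C_on_mult[OF assms(1)] C_on_const C_on_prod[OF assms(1)])
       (simp add: assms(2))
  with Cons show ?case
    by (simp add: a C_on_add[OF assms(1)] C_on_mult[OF assms(1)] C_on_const)
qed

lemma has_derivative_profile:
  fixes x :: "real ^ 7"
  assumes "(h has_real_derivative D) (at (x $ 5))"
  shows "((\<lambda>x. h (x $ 5)) has_derivative (\<lambda>w. w $ 5 * D)) (at x)"
  by (rule DERIV_compose_FDERIV[OF assms bounded_linear_imp_has_derivative[OF bounded_linear_vec_nth]])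

section \<open>Derivatives of the coframe\<close>

definition xi1_deriv :: "real ^ 7 \<Rightarrow> real ^ 7 \<Rightarrow> real ^ 7 \<Rightarrow> real" where
  "xi1_deriv x w v = 4 * w $ 6 * v $ 7 - 4 * inverse (rho (x $ 5)) ^ 7 * w $ 5 * v $ 1"

text \<open>The 36 arises from (rho^3)' = - 6 k rho^3. Its term is symmetric in \<open>w\<close> and
  \<open>v\<close> and drops out of the exterior derivative.\<close>

definition xi2_deriv :: "real ^ 7 \<Rightarrow> real ^ 7 \<Rightarrow> real ^ 7 \<Rightarrow> real" where
  "xi2_deriv x w v = - 6 * w $ 7 * rho (x $ 5) ^ 3 * v $ 5
     + 36 * x $ 7 * kap (x $ 5) * rho (x $ 5) ^ 3 * w $ 5 * v $ 5 - 4 * w $ 6 * v $ 1"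

definition xi3_deriv :: "real ^ 7 \<Rightarrow> real ^ 7 \<Rightarrow> real ^ 7 \<Rightarrow> real" where
  "xi3_deriv x w v = 6 * w $ 6 * rho (x $ 5) ^ 3 * v $ 5
     - 36 * x $ 6 * kap (x $ 5) * rho (x $ 5) ^ 3 * w $ 5 * v $ 5 - 4 * w $ 7 * v $ 1"

text \<open>In the last case \<open>10 + 2 * k ^ 2\<close> comes from (k rho^4)', as 10 (1 + k^2) -
  8 k^2.\<close>

definition frame_form_deriv :: "real ^ 7 \<Rightarrow> nat \<Rightarrow> real ^ 7 \<Rightarrow> real ^ 7 \<Rightarrow> real" where
  "frame_form_deriv x i w v =
    (let s = rho (x $ 5); k = kap (x $ 5); t = inverse s; r = w $ 5
     in if i = 1 then 0
      else if i = 2 then - 4 * k * s ^ 2 * r * v $ 6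
      else if i = 3 then t * xi3_deriv x w v + 2 * k * t * r * xi3 x v
      else if i = 4 then - 4 * k * s ^ 2 * r * v $ 7
      else if i = 5 then t * xi2_deriv x w v + 2 * k * t * r * xi2 x v
      else if i = 6 then 8 * k * s ^ 4 * r * xi1 x v - s ^ 4 * xi1_deriv x w v
      else 6 * k * t ^ 3 * r * v $ 1 + k * s ^ 4 * xi1_deriv x w v + (10 + 2 * k ^ 2) * s ^ 4 * r * xi1 x v)"

lemma frame_form_has_derivative:
  assumes "\<bar>x $ 5\<bar> < 1 / 10" and i: "i \<in> {1..7}"
  shows "((\<lambda>x. frame_form x i v) has_derivative (\<lambda>w. frame_form_deriv x i w v)) (at x)"
proof -
  have le: "\<bar>x $ 5\<bar> \<le> 1 / 10" using assms by simp
  note D [derivative_intros] = has_derivative_profile[OF DERIV_rho[OF le]] has_derivative_profile[OF DERIV_kap[OF le]]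
    has_derivative_profile[OF DERIV_inverse_rho[OF le]] has_derivative_profile[OF DERIV_prim[OF assms(1)]]
    bounded_linear_imp_has_derivative[OF bounded_linear_vec_nth]
  note alg = fun_eq_iff algebra_simps power2_eq_square power3_eq_cube power4_eq_xxxx
  have [derivative_intros]: "((\<lambda>x. xi1 x v) has_derivative (\<lambda>w. xi1_deriv x w v)) (at x)"
    unfolding xi1_def xi1_deriv_def by (rule has_derivative_eq_rhs, (rule derivative_intros)+, simp add: alg)
  have [derivative_intros]: "((\<lambda>x. xi2 x v) has_derivative (\<lambda>w. xi2_deriv x w v)) (at x)"
    unfolding xi2_def xi2_deriv_def by (rule has_derivative_eq_rhs, (rule derivative_intros)+, simp add: alg)
  have [derivative_intros]: "((\<lambda>x. xi3 x v) has_derivative (\<lambda>w. xi3_deriv x w v)) (at x)"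
    unfolding xi3_def xi3_deriv_def by (rule has_derivative_eq_rhs, (rule derivative_intros)+, simp add: alg)
  have "((\<lambda>x. frame_form x 1 v) has_derivative (\<lambda>w. frame_form_deriv x 1 w v)) (at x)"
    unfolding frame_form_simps by (simp add: frame_form_deriv_def D(5))
  moreover have "((\<lambda>x. frame_form x 2 v) has_derivative (\<lambda>w. frame_form_deriv x 2 w v)) (at x)"
    unfolding frame_form_simps by (rule has_derivative_eq_rhs, (rule derivative_intros)+, simp add: alg frame_form_deriv_def Let_def)
  moreover have "((\<lambda>x. frame_form x 3 v) has_derivative (\<lambda>w. frame_form_deriv x 3 w v)) (at x)"
    unfolding frame_form_simps by (rule has_derivative_eq_rhs, (rule derivative_intros)+, simp add: alg frame_form_deriv_def Let_def)
  moreover have "((\<lambda>x. frame_form x 4 v) has_derivative (\<lambda>w. frame_form_deriv x 4 w v)) (at x)"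
    unfolding frame_form_simps by (rule has_derivative_eq_rhs, (rule derivative_intros)+, simp add: alg frame_form_deriv_def Let_def)
  moreover have "((\<lambda>x. frame_form x 5 v) has_derivative (\<lambda>w. frame_form_deriv x 5 w v)) (at x)"
    unfolding frame_form_simps by (rule has_derivative_eq_rhs, (rule derivative_intros)+, simp add: alg frame_form_deriv_def Let_def)
  moreover have "((\<lambda>x. frame_form x 6 v) has_derivative (\<lambda>w. frame_form_deriv x 6 w v)) (at x)"
    unfolding frame_form_simps by (rule has_derivative_eq_rhs, (rule derivative_intros)+, simp add: alg frame_form_deriv_def Let_def)
  moreover have "((\<lambda>x. frame_form x 7 v) has_derivative (\<lambda>w. frame_form_deriv x 7 w v)) (at x)"
    unfolding frame_form_simps by (rule has_derivative_eq_rhs, (rule derivative_intros)+, simp add: alg frame_form_deriv_def Let_def)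
  ultimately show ?thesis
    using index_cases[OF i] by (elim disjE) simp_all
qed

section \<open>The structure equations\<close>

text \<open>The wedge of two 2-covectors as a sum over the six shuffles. It applies directly to
  antisymmetrised derivatives of 1-forms; the lists merely supply the arguments at positions 0 and
  1.\<close>

definition shuffle22 :: "'e covector \<Rightarrow> 'e covector \<Rightarrow> 'e covector" where
  "shuffle22 \<alpha> \<beta> v =
     \<alpha> (\<lambda>i. [v 0, v 1] ! i) * \<beta> (\<lambda>i. [v 2, v 3] ! i)
   - \<alpha> (\<lambda>i. [v 0, v 2] ! i) * \<beta> (\<lambda>i. [v 1, v 3] ! i)
   + \<alpha> (\<lambda>i. [v 0, v 3] ! i) * \<beta> (\<lambda>i. [v 1, v 2] ! i)
   + \<alpha> (\<lambda>i. [v 1, v 2] ! i) * \<beta> (\<lambda>i. [v 0, v 3] ! i)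
   - \<alpha> (\<lambda>i. [v 1, v 3] ! i) * \<beta> (\<lambda>i. [v 0, v 2] ! i)
   + \<alpha> (\<lambda>i. [v 2, v 3] ! i) * \<beta> (\<lambda>i. [v 0, v 1] ! i)"

lemma shuffle22_comb_form:
  assumes "comb_of_length 2 M"
  shows "comb_form e (comb_mult M [(c, [j, k])]) v = of_int c * shuffle22 (comb_form e M) (wedge_list [e j, e k]) v"
  using assms
proof (induction M)
  case Nil
  then show ?case by (simp add: comb_mult_def shuffle22_def)
next
  case (Cons a M)
  obtain d I where a: "a = (d, I)" by fastforce
  with Cons.prems obtain p q where I: "I = [p, q]"
    by (auto simp: numeral_2_eq_2 length_Suc_conv)
  have "comb_form e (comb_mult (a # M) [(c, [j, k])]) v
      = of_int d * of_int c * wedge_list [e p, e q, e j, e k] v + comb_form e (comb_mult M [(c, [j, k])]) v"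
    by (simp add: comb_mult_def a I)
  also have "wedge_list [e p, e q, e j, e k] v = shuffle22 (wedge_list [e p, e q]) (wedge_list [e j, e k]) v"
    unfolding shuffle22_def by (rule wedge_list_4)
  also have "of_int d * of_int c * shuffle22 (wedge_list [e p, e q]) (wedge_list [e j, e k]) v
      + comb_form e (comb_mult M [(c, [j, k])]) v
    = of_int c * shuffle22 (comb_form e (a # M)) (wedge_list [e j, e k]) v"
    using Cons a by (simp add: I) (simp add: shuffle22_def algebra_simps)
  finally show ?case .
qed

text \<open>Leibniz rule, with \<open>D l\<close> in the role of the exterior derivative of
  \<open>e l\<close>. Forms of degree two commute with all others, so each is moved to the front and
  only the middle term is negative.\<close>

definition comb_deriv :: "(nat \<Rightarrow> comb) \<Rightarrow> comb \<Rightarrow> comb" where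
  "comb_deriv D L = concat (map (\<lambda>(c, I).
     comb_mult (D (I ! 0)) [(c, [I ! 1, I ! 2])] @ comb_mult (D (I ! 1)) [(- c, [I ! 0, I ! 2])]
       @ comb_mult (D (I ! 2)) [(c, [I ! 0, I ! 1])]) L)"

text \<open>Leibniz rule for three 1-forms, where \<open>f'\<close>, \<open>g'\<close> and
  \<open>h'\<close> are the directional derivatives of their coefficients: the alternating sum over
  the direction antisymmetrises each of them.\<close>

lemma alternate_wedge_list_3:
  fixes v :: "nat \<Rightarrow> 'e"
  defines "w \<equiv> \<lambda>i j. if j < i then v j else v (Suc j)"
  shows "(\<Sum>i\<le>3. (- 1) ^ i * (wedge_list [f' (v i), g, h] (w i) + wedge_list [f, g' (v i), h] (w i)
      + wedge_list [f, g, h' (v i)] (w i)))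
    = shuffle22 (\<lambda>u. f' (u 0) (u 1) - f' (u 1) (u 0)) (wedge_list [g, h]) v
      - shuffle22 (\<lambda>u. g' (u 0) (u 1) - g' (u 1) (u 0)) (wedge_list [f, h]) v
      + shuffle22 (\<lambda>u. h' (u 0) (u 1) - h' (u 1) (u 0)) (wedge_list [f, g]) v"
proof -
  have sum4: "(\<Sum>i\<le>3. F i) = F 0 + F 1 + F 2 + (F 3 :: real)" for F :: "nat \<Rightarrow> real"
    by (simp add: numeral_3_eq_3 numeral_2_eq_2)
  show ?thesis
    unfolding sum4 shuffle22_def wedge_list_3 wedge_list_2 w_def
    by (simp add: numeral_3_eq_3 numeral_2_eq_2) (simp add: algebra_simps)
qed

text \<open>Hypothesis \<open>struct\<close> is the structure equation de^l = D0 l + a D1 l at the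
  point \<open>x\<close>. Here \<open>a\<close> is a number, the value at \<open>x\<close> of the
  varying coefficient.\<close>

lemma ext_deriv_comb_form:
  fixes E :: "'e::euclidean_space \<Rightarrow> nat \<Rightarrow> 'e \<Rightarrow> real"
  assumes L: "\<forall>(c, I)\<in>set L. length I = 3 \<and> set I \<subseteq> J"
    and E': "\<And>l v. l \<in> J \<Longrightarrow> ((\<lambda>x. E x l v) has_derivative (\<lambda>w. E' l w v)) (at x)"
    and struct: "\<And>l w v. l \<in> J \<Longrightarrow> E' l w v - E' l v w
       = comb_form (E x) (D0 l) (\<lambda>i. [w, v] ! i) + a * comb_form (E x) (D1 l) (\<lambda>i. [w, v] ! i)"
    and len: "\<And>l. l \<in> J \<Longrightarrow> comb_of_length 2 (D0 l) \<and> comb_of_length 2 (D1 l)"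
  shows "ext_deriv 3 (\<lambda>x. comb_form (E x) L) x v
    = comb_form (E x) (comb_deriv D0 L) v + a * comb_form (E x) (comb_deriv D1 L) v"
proof -
  define d where "d I u w = wedge_list [E' (I ! 0) w, E x (I ! 1), E x (I ! 2)] u
      + wedge_list [E x (I ! 0), E' (I ! 1) w, E x (I ! 2)] u
      + wedge_list [E x (I ! 0), E x (I ! 1), E' (I ! 2) w] u" for I u w
  define dL where "dL M u w = (\<Sum>(c, I)\<leftarrow>M. of_int c * d I u w)" for M :: comb and u w
  have der: "((\<lambda>x. comb_form (E x) L u) has_derivative (\<lambda>w. dL L u w)) (at x)" for u
    using L
  proof (induction L)
    case Nil
    then show ?case by (simp add: dL_def)
  next
    case (Cons m M)
    obtain c I where m: "m = (c, I)" by fastforce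
    with Cons.prems obtain i j k where I: "I = [i, j, k]" and J: "i \<in> J" "j \<in> J" "k \<in> J"
      by (auto simp: numeral_3_eq_3 length_Suc_conv)
    note [derivative_intros] = E'[OF J(1)] E'[OF J(2)] E'[OF J(3)]
    have single: "((\<lambda>x. wedge_list [E x i, E x j, E x k] u) has_derivative (\<lambda>w. d I u w)) (at x)"
      unfolding wedge_list_3 d_def I
      by (rule has_derivative_eq_rhs, (rule derivative_intros)+) (simp add: fun_eq_iff algebra_simps)
    have "((\<lambda>x. of_int c * wedge_list [E x i, E x j, E x k] u + comb_form (E x) M u)
        has_derivative (\<lambda>w. of_int c * d I u w + dL M u w)) (at x)"
      by (intro has_derivative_add has_derivative_mult_right single Cons.IH) (use Cons.prems in auto)
    then show ?case by (simp add: m I dL_def)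
  qed
  let ?w = "\<lambda>i j. if j < i then v j else v (Suc j)"
  have "ext_deriv 3 (\<lambda>x. comb_form (E x) L) x v = (\<Sum>i\<le>3. (- 1) ^ i * dL L (?w i) (v i))"
    unfolding ext_deriv_def by (simp only: frechet_derivativeI[OF der])
  also have "\<dots> = comb_form (E x) (comb_deriv D0 L) v + a * comb_form (E x) (comb_deriv D1 L) v"
    using L
  proof (induction L)
    case Nil
    then show ?case by (simp add: dL_def comb_deriv_def)
  next
    case (Cons m M)
    obtain c I where m: "m = (c, I)" by fastforce
    with Cons.prems obtain i j k where I: "I = [i, j, k]" and J: "i \<in> J" "j \<in> J" "k \<in> J"
      by (auto simp: numeral_3_eq_3 length_Suc_conv)
    \<comment> \<open>The hypothesis is phrased for lists of two vectors, and these are the only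
      arguments that \<open>shuffle22\<close> inspects.\<close>
    have A: "(\<lambda>u. E' l (u 0) (u 1) - E' l (u 1) (u 0)) (\<lambda>i. [p, q] ! i)
        = (\<lambda>u. comb_form (E x) (D0 l) u + a * comb_form (E x) (D1 l) u) (\<lambda>i. [p, q] ! i)" if "l \<in> J" for l p q
      using struct[OF that, of p q] by simp
    have B: "shuffle22 (\<lambda>u. E' l (u 0) (u 1) - E' l (u 1) (u 0)) \<beta> v
        = shuffle22 (comb_form (E x) (D0 l)) \<beta> v + a * shuffle22 (comb_form (E x) (D1 l)) \<beta> v"
      if "l \<in> J" for l \<beta>
      unfolding shuffle22_def A[OF that] by (simp add: algebra_simps)
    have "(\<Sum>i\<le>3. (- 1) ^ i * dL (m # M) (?w i) (v i))
        = of_int c * (\<Sum>i\<le>3. (- 1) ^ i * d I (?w i) (v i)) + (\<Sum>i\<le>3. (- 1) ^ i * dL M (?w i) (v i))"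
      by (simp only: sum_distrib_left sum.distrib[symmetric])
         (intro sum.cong refl, simp add: dL_def m algebra_simps)
    also have "(\<Sum>i\<le>3. (- 1) ^ i * d I (?w i) (v i))
        = shuffle22 (\<lambda>u. E' i (u 0) (u 1) - E' i (u 1) (u 0)) (wedge_list [E x j, E x k]) v
        - shuffle22 (\<lambda>u. E' j (u 0) (u 1) - E' j (u 1) (u 0)) (wedge_list [E x i, E x k]) v
        + shuffle22 (\<lambda>u. E' k (u 0) (u 1) - E' k (u 1) (u 0)) (wedge_list [E x i, E x j]) v"
      unfolding d_def I using alternate_wedge_list_3[of "E' i" v "E x j" "E x k" "E x i" "E' j" "E' k"] by simp
    also have "(\<Sum>i\<le>3. (- 1) ^ i * dL M (?w i) (v i))
        = comb_form (E x) (comb_deriv D0 M) v + a * comb_form (E x) (comb_deriv D1 M) v"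
      using Cons.prems by (intro Cons.IH) auto
    finally have sum: "(\<Sum>i\<le>3. (- 1) ^ i * dL (m # M) (?w i) (v i))
        = of_int c * (shuffle22 (\<lambda>u. E' i (u 0) (u 1) - E' i (u 1) (u 0)) (wedge_list [E x j, E x k]) v
        - shuffle22 (\<lambda>u. E' j (u 0) (u 1) - E' j (u 1) (u 0)) (wedge_list [E x i, E x k]) v
        + shuffle22 (\<lambda>u. E' k (u 0) (u 1) - E' k (u 1) (u 0)) (wedge_list [E x i, E x j]) v)
        + (comb_form (E x) (comb_deriv D0 M) v + a * comb_form (E x) (comb_deriv D1 M) v)" .
    have C: "comb_form (E x) (comb_deriv D (m # M)) v
        = of_int c * (shuffle22 (comb_form (E x) (D i)) (wedge_list [E x j, E x k]) v
          - shuffle22 (comb_form (E x) (D j)) (wedge_list [E x i, E x k]) v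
          + shuffle22 (comb_form (E x) (D k)) (wedge_list [E x i, E x j]) v)
          + comb_form (E x) (comb_deriv D M) v"
      if "\<And>l. l \<in> J \<Longrightarrow> comb_of_length 2 (D l)" for D
      using that J by (simp add: comb_deriv_def m I shuffle22_comb_form algebra_simps)
    have len0: "\<And>l. l \<in> J \<Longrightarrow> comb_of_length 2 (D0 l)" and len1: "\<And>l. l \<in> J \<Longrightarrow> comb_of_length 2 (D1 l)"
      using len by blast+
    have C0: "comb_form (E x) (comb_deriv D0 (m # M)) v
        = of_int c * (shuffle22 (comb_form (E x) (D0 i)) (wedge_list [E x j, E x k]) v
          - shuffle22 (comb_form (E x) (D0 j)) (wedge_list [E x i, E x k]) v
          + shuffle22 (comb_form (E x) (D0 k)) (wedge_list [E x i, E x j]) v)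
          + comb_form (E x) (comb_deriv D0 M) v"
      by (rule C) (rule len0)
    have C1: "comb_form (E x) (comb_deriv D1 (m # M)) v
        = of_int c * (shuffle22 (comb_form (E x) (D1 i)) (wedge_list [E x j, E x k]) v
          - shuffle22 (comb_form (E x) (D1 j)) (wedge_list [E x i, E x k]) v
          + shuffle22 (comb_form (E x) (D1 k)) (wedge_list [E x i, E x j]) v)
          + comb_form (E x) (comb_deriv D1 M) v"
      by (rule C) (rule len1)
    show ?case
      unfolding sum B[OF J(1)] B[OF J(2)] B[OF J(3)] C0 C1
      by (simp add: algebra_simps)
  qed
  finally show ?thesis .
qed

text \<open>The part of de^i without k; \<open>structure1\<close> is the factor of k.\<close>

definition structure0 :: "nat \<Rightarrow> comb" where
  "structure0 i =
     (if i = 3 then [(- 6, [1, 2]), (- 4, [4, 7])]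
      else if i = 5 then [(- 6, [4, 1]), (- 4, [2, 7])]
      else if i = 6 then [(- 4, [2, 4]), (4, [1, 7])]
      else if i = 7 then [(- 10, [1, 6])] else [])"

definition structure1 :: "nat \<Rightarrow> comb" where
  "structure1 i =
     (if i = 2 then [(- 4, [1, 2])]
      else if i = 3 then [(2, [1, 3]), (- 4, [4, 6])]
      else if i = 4 then [(- 4, [1, 4])]
      else if i = 5 then [(2, [1, 5]), (- 4, [2, 6])]
      else if i = 6 then [(- 4, [1, 6])]
      else if i = 7 then [(2, [1, 7]), (4, [2, 4])] else [])"

text \<open>Coordinate differentials are rewritten in the coframe by dy = rho^-2 e^2, dz = rho^-2
  e^4 and dt = rho^3 (e^7 + k e^6), with t the first angle; all powers of rho then cancel.\<close>

lemma structure_equation: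
  assumes "\<bar>x $ 5\<bar> < 1 / 10" and i: "i \<in> {1..7}"
  shows "frame_form_deriv x i w v - frame_form_deriv x i v w
    = comb_form (frame_form x) (structure0 i) (\<lambda>n. [w, v] ! n)
      + kap (x $ 5) * comb_form (frame_form x) (structure1 i) (\<lambda>n. [w, v] ! n)"
proof -
  have "rho (x $ 5) \<noteq> 0" using rho_pos[of "x $ 5"] assms by simp
  then show ?thesis
    using index_cases[OF i] unfolding structure0_def structure1_def frame_form_deriv_def Let_def
      xi1_deriv_def xi2_deriv_def xi3_deriv_def
    by (elim disjE; simp add: wedge_list_2 frame_form_simps xi1_def xi2_def xi3_def frame_form_def)
       (simp_all add: field_simps eval_nat_numeral)
qed

text \<open>The nearly parallel equation holds for all values of k at once: the part without k is 4
  times the dual form, and the factor of k vanishes.\<close>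

lemma structure_checks:
  "comb_is_zero (comb_deriv structure0 G2_comb @ comb_scale (- 4) G2_dual_comb)"
  "comb_is_zero (comb_deriv structure1 G2_comb)"
  by code_simp+

lemma ext_deriv_G2:
  assumes "\<bar>x $ 5\<bar> < 1 / 10"
  shows "ext_deriv 3 (\<lambda>x. comb_form (frame_form x) G2_comb) x v = 4 * comb_form (frame_form x) G2_dual_comb v"
proof -
  have "ext_deriv 3 (\<lambda>x. comb_form (frame_form x) G2_comb) x v
      = comb_form (frame_form x) (comb_deriv structure0 G2_comb) v
        + kap (x $ 5) * comb_form (frame_form x) (comb_deriv structure1 G2_comb) v"
  proof (rule ext_deriv_comb_form)
    show "\<forall>(c, I)\<in>set G2_comb. length I = 3 \<and> set I \<subseteq> {1..7}"
      by (simp add: G2_comb_def)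
    show "comb_of_length 2 (structure0 l) \<and> comb_of_length 2 (structure1 l)" for l
      by (simp add: structure0_def structure1_def)
  qed (rule frame_form_has_derivative[OF assms] structure_equation[OF assms]; assumption)+
  then show ?thesis
    using comb_form_is_zero[OF structure_checks(1), of "frame_form x" v]
      comb_form_is_zero[OF structure_checks(2), of "frame_form x" v]
    by (simp add: comb_form_scale)
qed

section \<open>Incompleteness and the nearly parallel structure\<close>

interpretation torus_times_open base_domain
  by unfold_locales (rule open_base_domain)

lemma frame_form_cong: "base x = base y \<Longrightarrow> frame_form x = frame_form y"
  by (simp add: fun_eq_iff vec_eq_iff forall_3 frame_form_def xi1_def xi2_def xi3_def)

text \<open>The chart argument is ignored, since transition maps are local translations of the
  angles, on which the coframe does not depend.\<close>

definition frame_metric :: "(point, real ^ 7) metric" where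
  "frame_metric c x = coframe_metric (frame_form x)"

lemma frame_metric_ge: "(v $ 5)\<^sup>2 \<le> frame_metric c x v v"
proof -
  have "frame_form x 1 v * frame_form x 1 v \<le> (\<Sum>i=1..7. frame_form x i v * frame_form x i v)"
    by (rule member_le_sum) auto
  then show ?thesis
    by (simp add: frame_metric_def coframe_metric_def frame_form_simps[simplified] power2_eq_square)
qed

text \<open>On the line y = z = 0 the dr-terms of \<open>xi2\<close> and \<open>xi3\<close> vanish,
  so a radial vector pairs with e^1 only.\<close>

lemma frame_metric_radial:
  assumes "x $ 6 = 0" "x $ 7 = 0" and "v $ 1 = 0" "v $ 2 = 0" "v $ 3 = 0" "v $ 4 = 0" "v $ 6 = 0" "v $ 7 = 0"
  shows "frame_metric c x v v = (v $ 5)\<^sup>2"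
  unfolding frame_metric_def coframe_metric_def sum_1_7 frame_form_simps xi1_def xi2_def xi3_def
  by (simp add: assms power2_eq_square)

lemma chart_image_bound:
  assumes "x \<in> chart_image a" shows "\<bar>x $ 5\<bar> < 1 / 10"
proof -
  have "base x \<in> base_domain" using assms by (simp add: chart_image_def)
  then show ?thesis by (simp add: base_domain_def)
qed

lemma cover_in_space: "base x \<in> base_domain \<Longrightarrow> cover x \<in> topspace space_top"
  by (simp add: cover_def)

text \<open>Segments in the covering coordinates stay in the slab by convexity and have the same
  velocity in every chart. They bound distances from above and connect any two points.\<close>

lemma curve_of_length_line:
  assumes x: "base x \<in> base_domain" and y: "base y \<in> base_domain"
  defines "l \<equiv> \<lambda>t. x + t *\<^sub>R (y - x)"
  shows "curve_of_length space_top atlas frame_metric (\<lambda>t. cover (l t))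
    (integral {0..1} (\<lambda>t. sqrt (frame_metric c (l t) (y - x) (y - x))))"
  unfolding curve_of_length_def
proof (intro conjI exI[of _ "{}"] exI[of _ "\<lambda>t. sqrt (frame_metric c (l t) (y - x) (y - x))"] ballI impI)
  have l_dom: "base (l t) \<in> base_domain" if "t \<in> {0..1}" for t
  proof -
    have "base (l t) = (1 - t) *\<^sub>R base x + t *\<^sub>R base y"
      by (simp add: l_def vec_eq_iff forall_3 algebra_simps)
    then show ?thesis
      using convexD[OF convex_base_domain x y, of "1 - t" t] that by simp
  qed
  have l_cont: "continuous_on T l" for T
    unfolding l_def by (intro continuous_intros)
  have "continuous_on {0..1} (\<lambda>t. cover (l t))"
    by (rule continuous_on_compose2[OF continuous_on_cover[of UNIV] l_cont]) simp
  then show "continuous_map (top_of_set {0..1}) space_top (\<lambda>t. cover (l t))"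
    using cover_in_space[OF l_dom] by (auto simp: space_top_def)
  have deriv: "((coord c' \<circ> (\<lambda>t. cover (l t))) has_vector_derivative (y - x)) (at t)"
    if "c' \<in> atlas" "cover (l t) \<in> dom_of c'" for c' t
  proof -
    obtain a where a: "c' = chart a" using \<open>c' \<in> atlas\<close> by (auto simp: atlas_def)
    have "(l has_derivative (\<lambda>t. t *\<^sub>R (y - x))) (at t)"
      unfolding l_def by (auto intro!: derivative_eq_intros)
    from has_derivative_compose[OF this coord_cover_has_derivative] that(2)
    show ?thesis by (simp add: a has_vector_derivative_def o_def)
  qed
  show "(coord c' \<circ> (\<lambda>t. cover (l t))) C1_differentiable_on ({t \<in> {0..1}. cover (l t) \<in> dom_of c'} - {})"
    if "c' \<in> atlas" for c'
    unfolding C1_differentiable_on_def using deriv[OF that]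
    by (intro exI[of _ "\<lambda>_. y - x"]) auto
  show "sqrt (frame_metric c (l t) (y - x) (y - x)) =
      (let w = vector_derivative (coord c' \<circ> (\<lambda>t. cover (l t))) (at t)
       in sqrt (frame_metric c' (coord c' (cover (l t))) w w))"
    if "t \<in> {0..1} - {}" "c' \<in> atlas" "cover (l t) \<in> dom_of c'" for t c'
  proof -
    have "base (coord c' (cover (l t))) = base (l t)"
      using \<open>c' \<in> atlas\<close> by (auto simp: atlas_def base_coord_chart cover_def)
    then show ?thesis
      by (simp only: vector_derivative_at[OF deriv[OF that(2,3)]] Let_def frame_metric_def
          frame_form_cong[of "coord c' (cover (l t))" "l t"])
  qed
  let ?S = "{x :: real ^ 7. \<bar>x $ 5\<bar> < 1 / 10}"
  have "open ?S" by (intro open_Collect_less continuous_intros)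
  then have form: "continuous_on ?S (\<lambda>x. frame_form x i v)" for i v
    using C_on_frame_form[of ?S 0 i v] by simp
  have "l ` {0..1} \<subseteq> ?S"
    using l_dom by (auto simp: base_domain_def)
  then have "continuous_on {0..1} (\<lambda>t. frame_form (l t) i (y - x))" for i
    by (intro continuous_on_compose2[OF form l_cont]) auto
  then have "continuous_on {0..1} (\<lambda>t. sqrt (frame_metric c (l t) (y - x) (y - x)))"
    unfolding frame_metric_def coframe_metric_def by (intro continuous_intros)
  then show "((\<lambda>t. sqrt (frame_metric c (l t) (y - x) (y - x))) has_integral
      integral {0..1} (\<lambda>t. sqrt (frame_metric c (l t) (y - x) (y - x)))) {0..1}"
    by (intro integrable_integral integrable_continuous_interval)
qed simp

text \<open>Since dr is a member of the orthonormal coframe, r changes no faster than arc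
  length.\<close>

lemma length_ge_coordinate:
  assumes "curve_of_length space_top atlas frame_metric \<gamma> L"
  shows "\<bar>snd (\<gamma> 0) $ 1 - snd (\<gamma> 1) $ 1\<bar> \<le> L"
proof -
  obtain S s where cont: "continuous_map (top_of_set {0..1}) space_top \<gamma>" and S: "finite S"
    and C1: "\<And>c. c \<in> atlas \<Longrightarrow> (coord c \<circ> \<gamma>) C1_differentiable_on ({t\<in>{0..1}. \<gamma> t \<in> dom_of c} - S)"
    and speed: "\<And>t c. t \<in> {0..1} - S \<Longrightarrow> c \<in> atlas \<Longrightarrow> \<gamma> t \<in> dom_of c \<Longrightarrow>
      s t = (let w = vector_derivative (coord c \<circ> \<gamma>) (at t) in sqrt (frame_metric c (coord c (\<gamma> t)) w w))"
    and int: "(s has_integral L) {0..1}"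
    using assms unfolding curve_of_length_def by blast
  define f where "f t = snd (\<gamma> t) $ 1" for t
  define f' where "f' t = vector_derivative f (at t)" for t
  have \<gamma>: "\<gamma> t \<in> torus \<times> base_domain" if "t \<in> {0..1}" for t
    using cont that by (auto simp: space_top_def Pi_iff)
  have "continuous_on {0..1} \<gamma>"
    using cont by (simp add: space_top_def)
  then have "continuous_on {0..1} f"
    unfolding f_def by (intro continuous_intros)
  have der: "(f has_vector_derivative f' t) (at t) \<and> norm (f' t) \<le> s t" if t: "t \<in> {0..1} - S" for t
  proof -
    have "\<gamma> t \<in> (\<Union>c\<in>atlas. dom_of c)"
      using \<gamma>[of t] t smooth_manifold_atlas by (simp add: smooth_manifold_def)
    then obtain a where a: "\<gamma> t \<in> dom_of (chart a)" by (auto simp: atlas_def)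
    have atl: "chart a \<in> atlas" by (simp add: atlas_def)
    obtain D where D: "(coord (chart a) \<circ> \<gamma> has_vector_derivative D) (at t)"
      using C1[OF atl] t a unfolding C1_differentiable_on_def by blast
    have "f = (\<lambda>t. (coord (chart a) \<circ> \<gamma>) t $ 5)"
      by (simp add: f_def fun_eq_iff chart_def)
    moreover have "((\<lambda>t. (coord (chart a) \<circ> \<gamma>) t $ 5) has_vector_derivative D $ 5) (at t)"
      by (rule bounded_linear.has_vector_derivative[OF bounded_linear_vec_nth D])
    ultimately have f: "(f has_vector_derivative D $ 5) (at t)" by simp
    then have f': "f' t = D $ 5" unfolding f'_def by (rule vector_derivative_at)
    have "s t = sqrt (frame_metric (chart a) (coord (chart a) (\<gamma> t)) D D)"
      using speed[OF t atl a] by (simp add: vector_derivative_at[OF D])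
    moreover have "sqrt ((D $ 5)\<^sup>2) \<le> sqrt (frame_metric (chart a) (coord (chart a) (\<gamma> t)) D D)"
      by (rule real_sqrt_le_mono[OF frame_metric_ge])
    ultimately show ?thesis using f f' by simp
  qed
  have "(f' has_integral f 1 - f 0) {0..1}"
    using S \<open>continuous_on {0..1} f\<close> der
    by (intro fundamental_theorem_of_calculus_interior_strong[of S]) auto
  \<comment> \<open>On the exceptional set \<open>S\<close> the speed is unspecified; replacing it
    there by \<open>norm (f' t)\<close> makes the bound hold at every parameter without changing the
    integral.\<close>
  moreover define s0 where "s0 t = (if t \<in> S then norm (f' t) else s t)" for t
  have "(s0 has_integral L) {0..1}"
    by (rule has_integral_spike_finite[OF S _ int]) (simp add: s0_def)
  ultimately have "norm (f 1 - f 0) \<le> L"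
    using integral_norm_bound_integral[of f' "{0..1}" s0] der by (auto simp: s0_def integral_unique has_integral_integrable)
  then show ?thesis by (simp add: f_def abs_minus_commute)
qed

lemma riemannian_dist_le:
  assumes "curve_of_length space_top atlas frame_metric \<gamma> L"
  shows "riemannian_dist space_top atlas frame_metric (\<gamma> 0) (\<gamma> 1) \<le> L"
  unfolding riemannian_dist_def
proof (rule cInf_lower)
  show "bdd_below {L. \<exists>\<delta>. \<delta> 0 = \<gamma> 0 \<and> \<delta> 1 = \<gamma> 1 \<and> curve_of_length space_top atlas frame_metric \<delta> L}"
    by (rule bdd_belowI[of _ 0]) (use length_ge_coordinate in \<open>fastforce intro: order_trans[OF abs_ge_zero]\<close>)
qed (use assms in blast)

text \<open>A lower bound passes to the infimum only for a nonempty set of lengths, so a connecting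
  segment is lifted to the covering.\<close>

lemma riemannian_dist_ge:
  assumes "p \<in> topspace space_top" "q \<in> topspace space_top"
  shows "\<bar>snd p $ 1 - snd q $ 1\<bar> \<le> riemannian_dist space_top atlas frame_metric p q"
  unfolding riemannian_dist_def
proof (rule cInf_greatest)
  have lift: "\<exists>x. base x \<in> base_domain \<and> cover x = r" if "r \<in> topspace space_top" for r
  proof -
    have "fst r \<in> torus" using that by auto
    then obtain t where "fst r = torus_exp t" by (rule torus_exp_surj)
    then show ?thesis using that by (intro exI[of _ "join t (snd r)"]) (auto simp: cover_def prod_eq_iff)
  qed
  obtain x y where "base x \<in> base_domain" "cover x = p" "base y \<in> base_domain" "cover y = q"
    using lift[OF assms(1)] lift[OF assms(2)] by blast
  then show "{L. \<exists>\<gamma>. \<gamma> 0 = p \<and> \<gamma> 1 = q \<and> curve_of_length space_top atlas frame_metric \<gamma> L} \<noteq> {}"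
    using curve_of_length_line[of x y] by fastforce
next
  fix L assume "L \<in> {L. \<exists>\<gamma>. \<gamma> 0 = p \<and> \<gamma> 1 = q \<and> curve_of_length space_top atlas frame_metric \<gamma> L}"
  then show "\<bar>snd p $ 1 - snd q $ 1\<bar> \<le> L" using length_ge_coordinate by blast
qed

text \<open>Radial segments bound the distances of the sequence from above, and r is 1-Lipschitz for
  the distance; a limit point would thus have r = 1 / 10, which the strict bound excludes.\<close>

lemma not_riemannian_complete: "\<not> riemannian_complete space_top atlas frame_metric"
proof
  assume complete: "riemannian_complete space_top atlas frame_metric"
  define r where "r n = 1 / 10 * (1 + - inverse (real (Suc n)))" for n :: nat
  define x where "x n = join 0 (vector [r n, 0, 0])" for n
  have r: "0 \<le> r n" "r n < 1 / 10" for n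
    by (simp_all add: r_def field_simps)
  have lim: "r \<longlonglongrightarrow> 1 / 10"
    unfolding r_def by (rule LIMSEQ_inverse_real_of_nat_add_minus_mult)
  have dom: "base (x n) \<in> base_domain" for n
    using r[of n] by (simp add: x_def base_domain_def vector_3)
  have dist: "riemannian_dist space_top atlas frame_metric (cover (x m)) (cover (x n)) \<le> \<bar>r m - r n\<bar>" for m n
  proof -
    let ?l = "\<lambda>t. x m + t *\<^sub>R (x n - x m)"
    \<comment> \<open>Any chart will do here, as \<open>frame_metric\<close> ignores it.\<close>
    have "frame_metric undefined (?l t) (x n - x m) (x n - x m) = (r n - r m)\<^sup>2" for t
      by (subst frame_metric_radial) (simp_all add: x_def vector_3)
    then have "integral {0..1} (\<lambda>t. sqrt (frame_metric undefined (?l t) (x n - x m) (x n - x m))) = \<bar>r m - r n\<bar>"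
      by simp
    then show ?thesis
      using riemannian_dist_le[OF curve_of_length_line[OF dom[of m] dom[of n], of undefined]] by simp
  qed
  have "\<exists>N. \<forall>m\<ge>N. \<forall>n\<ge>N. riemannian_dist space_top atlas frame_metric (cover (x m)) (cover (x n)) < \<epsilon>"
    if "\<epsilon> > 0" for \<epsilon>
  proof -
    from LIMSEQ_imp_Cauchy[OF lim] that obtain N where "\<And>m n. m \<ge> N \<Longrightarrow> n \<ge> N \<Longrightarrow> \<bar>r m - r n\<bar> < \<epsilon>"
      unfolding Cauchy_def dist_real_def by blast
    then show ?thesis using dist by (meson order_le_less_trans)
  qed
  moreover have "range (\<lambda>n. cover (x n)) \<subseteq> topspace space_top"
    using cover_in_space[OF dom] by blast
  ultimately obtain p where p: "p \<in> topspace space_top"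
      and conv: "(\<lambda>n. riemannian_dist space_top atlas frame_metric (cover (x n)) p) \<longlonglongrightarrow> 0"
    using complete unfolding riemannian_complete_def by blast
  have "\<bar>r n - snd p $ 1\<bar> \<le> riemannian_dist space_top atlas frame_metric (cover (x n)) p" for n
    using riemannian_dist_ge[OF cover_in_space[OF dom[of n]] p] by (simp add: cover_def x_def vector_3)
  then have "(\<lambda>n. r n - snd p $ 1) \<longlonglongrightarrow> 0"
    by (intro Lim_null_comparison[OF _ conv]) simp
  moreover have "(\<lambda>n. r n - snd p $ 1) \<longlonglongrightarrow> 1 / 10 - snd p $ 1"
    by (intro tendsto_intros lim)
  ultimately have "snd p $ 1 = 1 / 10"
    using LIMSEQ_unique by fastforce
  moreover have "snd p \<in> base_domain" using p by auto
  ultimately show False by (simp add: base_domain_def)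
qed

section \<open>The G2-structure in all charts\<close>

definition G2_form :: "(point, real ^ 7) form" where
  "G2_form c x = standard_G2_form (frame_form x)"

definition G2_volume :: "(point, real ^ 7) form" where
  "G2_volume c x = wedge_list (map (frame_form x) [1..<8])"

lemma dual_coframe_chart:
  assumes "c \<in> atlas" "x \<in> coord c ` dom_of c"
  shows "dual_coframe (frame_form x) (frame_vector x)" and "\<bar>x $ 5\<bar> < 1 / 10"
proof -
  obtain a where c: "c = chart a" using assms(1) by (auto simp: atlas_def)
  show "\<bar>x $ 5\<bar> < 1 / 10"
    using assms(2) unfolding c image_chart by (rule chart_image_bound)
  then show "dual_coframe (frame_form x) (frame_vector x)"
    by (intro dual_coframe_frame_form) simp
qed

lemma G2_structure_G2_form: "G2_structure atlas G2_form"
  unfolding G2_structure_def differential_form_def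
proof (intro conjI ballI allI)
  fix c x assume cx: "c \<in> atlas" "x \<in> coord c ` dom_of c"
  interpret dual_coframe "frame_form x" "frame_vector x" by (rule dual_coframe_chart[OF cx])
  show "kcovector 3 (G2_form c x)"
    unfolding G2_form_def standard_G2_form_eq by (rule kcovector_comb_form) (simp add: G2_comb_def)
  show "\<exists>e. coframe e \<and> G2_form c x = standard_G2_form e"
    using coframe by (auto simp: G2_form_def)
next
  fix c v assume c: "c \<in> atlas"
  then obtain a where "coord c ` dom_of c = chart_image a" by (auto simp: atlas_def)
  then show "smooth_on (\<lambda>x. G2_form c x v) (coord c ` dom_of c)"
    unfolding smooth_on_def G2_form_def standard_G2_form_eq
    by (simp add: C_on_comb_form[OF open_chart_image] C_on_frame_form[OF open_chart_image chart_image_bound])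
next
  fix c d p assume *: "c \<in> atlas" "d \<in> atlas" "p \<in> dom_of c \<inter> dom_of d"
  then have eq: "base (coord c p) = base (coord d p)" by (auto simp: atlas_def base_coord_chart)
  show "G2_form c (coord c p) =
      pullback (frechet_derivative (coord d \<circ> coord_inv c) (at (coord c p))) (G2_form d (coord d p))"
    unfolding pullback_transition[OF *] G2_form_def by (simp only: frame_form_cong[OF eq])
qed

lemma G2_metric_and_volume_G2_form: "G2_metric_and_volume atlas G2_form frame_metric G2_volume"
  unfolding G2_metric_and_volume_def
proof (intro ballI)
  fix c x assume cx: "c \<in> atlas" "x \<in> coord c ` dom_of c"
  interpret dual_coframe "frame_form x" "frame_vector x" by (rule dual_coframe_chart[OF cx])
  show "inner_product_form (frame_metric c x) \<and> volume_form_of (frame_metric c x) (G2_volume c x) \<and>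
    (\<forall>X Y v. 6 * frame_metric c x X Y * G2_volume c x v =
      wedge 4 3 (wedge 2 2 (interior_prod X (G2_form c x)) (interior_prod Y (G2_form c x))) (G2_form c x) v)"
    unfolding frame_metric_def G2_volume_def G2_form_def standard_G2_form_eq
    using inner_product_form_metric volume_form_of_metric G2_metric_identity by blast
qed

lemma nearly_parallel_G2_form: "nearly_parallel atlas G2_form frame_metric G2_volume"
  unfolding nearly_parallel_def
proof (intro ballI exI conjI)
  fix c x assume cx: "c \<in> atlas" "x \<in> coord c ` dom_of c"
  interpret dual_coframe "frame_form x" "frame_vector x" by (rule dual_coframe_chart[OF cx])
  show "is_hodge_star (frame_metric c x) (G2_volume c x) 3 (G2_form c x) (comb_form (frame_form x) G2_dual_comb)"
    unfolding frame_metric_def G2_volume_def G2_form_def standard_G2_form_eq by (rule is_hodge_star_G2)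
  show "ext_deriv 3 (G2_form c) x = (\<lambda>v. 4 * comb_form (frame_form x) G2_dual_comb v)"
    unfolding G2_form_def[abs_def] standard_G2_form_eq
    by (rule ext) (rule ext_deriv_G2[OF dual_coframe_chart(2)[OF cx]])
qed

theorem corollary4p7:
  shows "\<exists>(M :: point topology) (A :: (point, real ^ 7) chart set)
            (\<phi> :: (point, real ^ 7) form) (g :: (point, real ^ 7) metric)
            (vol :: (point, real ^ 7) form) (act :: (complex ^ 4) \<Rightarrow> point \<Rightarrow> point).
           smooth_manifold M A \<and> connected_space M \<and>
           G2_structure A \<phi> \<and> G2_metric_and_volume A \<phi> g vol \<and>
           nearly_parallel A \<phi> g vol \<and>
           \<not> riemannian_complete M A g \<and>
           smooth_torus_action M A act \<and> effective_torus_action M act \<and>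
           (\<forall>t\<in>torus. preserves_form A \<phi> (act t))"
proof (intro exI conjI ballI)
  show "smooth_manifold space_top atlas" by (rule smooth_manifold_atlas)
  show "connected_space space_top"
    by (intro connected_space_top convex_connected convex_base_domain)
  show "G2_structure atlas G2_form" by (rule G2_structure_G2_form)
  show "G2_metric_and_volume atlas G2_form frame_metric G2_volume" by (rule G2_metric_and_volume_G2_form)
  show "nearly_parallel atlas G2_form frame_metric G2_volume" by (rule nearly_parallel_G2_form)
  show "\<not> riemannian_complete space_top atlas frame_metric" by (rule not_riemannian_complete)
  show "smooth_torus_action space_top atlas torus_action" by (rule smooth_torus_action_atlas)
  have "0 \<in> base_domain" by (simp add: base_domain_def)
  then show "effective_torus_action space_top torus_action"
    by (intro effective_torus_action_space_top) blast
  fix t :: "complex ^ 4" assume "t \<in> torus"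
  then show "preserves_form atlas G2_form (torus_action t)"
    by (rule preserves_form_torus_action) (metis G2_form_def frame_form_cong)
qed

end
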